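(* Let $A$ be a vector space with four binary operations $\lhd,\rhd,\diamond,\succ$ and let $P=\mathbf k[\partial]\otimes_{\mathbf k}A$ be the free $\mathbf k[\partial]$-module. Define $$a\circ_\lambda b:=\partial(b\lhd a)+\lambda(a\rhd b+b\lhd a)+a\diamond b,\qquad a\succ_\lambda b:=a\succ b,\qquad a,b\in A,$$ (extended to $P$ by sesquilinearity). Then $(P,\circ_\lambda,\succ_\lambda)$ is a pre-Poisson conformal algebra if and only if $(A,\lhd,\rhd,\succ,\diamond)$ is a pre-PGD-algebra.
   Context: Let $\mathbf k$ be a field of characteristic $0$; vector spaces are over $\mathbf k$ and assumed finite-dimensional, binary operations are bilinear. Sesquilinearity of a $\lambda$-product $\ast_\lambda$ means $(\partial a)\ast_\lambda b=-\lambda a\ast_\lambda b$ and $a\ast_\lambda(\partial b)=(\partial+\lambda)a\ast_\lambda b$. A left-symmetric conformal algebra $(P,\circ_\lambda)$ is a $\mathbf k[\partial]$-module with a $\mathbf k$-bilinear sesquilinear map $\circ_\lambda:P\times P\to P[\lambda]$ with $a\circ_\lambda(b\circ_\mu c)-(a\circ_\lambda b)\circ_{\lambda+\mu}c=b\circ_\mu(a\circ_\lambda c)-(b\circ_\mu a)\circ_{\lambda+\mu}c$. A Zinbiel conformal algebra $(P,\succ_\lambda)$ is a $\mathbf k[\partial]$-module with a $\mathbf k$-bilinear sesquilinear map $\succ_\lambda:P\times P\to P[\lambda]$ with $a\succ_\lambda(b\succ_\mu c)=(a\succ_\lambda b+b\succ_{-\lambda-\partial}a)\succ_{\lambda+\mu}c$.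 A pre-Poisson conformal algebra $(P,\circ_\lambda,\succ_\lambda)$ is both, with $(a\circ_\lambda b-b\circ_{-\lambda-\partial}a)\succ_{\lambda+\mu}c=a\circ_\lambda(b\succ_\mu c)-b\succ_\mu(a\circ_\lambda c)$ and $(a\succ_\lambda b+b\succ_{-\lambda-\partial}a)\circ_{\lambda+\mu}c=a\succ_\lambda(b\circ_\mu c)+b\succ_\mu(a\circ_\lambda c)$. (If $b\circ_\nu a=\sum_k\nu^kc_k$, then $b\circ_{-\lambda-\partial}a=\sum_k(-\lambda-\partial)^kc_k$.) Zinbiel algebra $(A,\succ)$: $a\succ(b\succ c)=(b\succ a+a\succ b)\succ c$. Left-symmetric algebra $(A,\diamond)$: $(a\diamond b)\diamond c-a\diamond(b\diamond c)=(b\diamond a)\diamond c-b\diamond(a\diamond c)$. Pre-Novikov algebra $(A,\lhd,\rhd)$: $a\rhd(b\rhd c)=(a\rhd b+a\lhd b)\rhd c+b\rhd(a\rhd c)-(b\rhd a+b\lhd a)\rhd c$; $a\rhd(b\lhd c)=(a\rhd b)\lhd c+b\lhd(a\lhd c+a\rhd c)-(b\lhd a)\lhd c$; $(a\lhd b+a\rhd b)\rhd c=(a\rhd c)\lhd b$; $(a\lhd b)\lhd c=(a\lhd c)\lhd b$. Pre-GD-algebra $(A,\lhd,\rhd,\diamond)$: $(A,\lhd,\rhd)$ pre-Novikov, $(A,\diamond)$ left-symmetric, and $c\lhd(a\diamond b-b\diamond a)-a\diamond(c\lhd b)-(b\diamond c)\lhd a=-b\diamond(c\lhd a)-(a\diamond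 c)\lhd b$; $(a\diamond b-b\diamond a)\rhd c+(a\lhd b+a\rhd b)\diamond c=a\rhd(b\diamond c)-b\diamond(a\rhd c)+(a\diamond c)\lhd b$. Pre-Poisson algebra $(A,\diamond,\succ)$: $(A,\diamond)$ left-symmetric, $(A,\succ)$ Zinbiel, and $(a\diamond b-b\diamond a)\succ c=a\diamond(b\succ c)-b\succ(a\diamond c)$; $(a\succ b+b\succ a)\diamond c=a\succ(b\diamond c)+b\succ(a\diamond c)$. Pre-differential Novikov-Poisson algebra $(A,\lhd,\rhd,\succ)$: $(A,\lhd,\rhd)$ pre-Novikov, $(A,\succ)$ Zinbiel, and $(a\succ b+b\succ a)\rhd c=a\succ(b\rhd c)$; $(a\succ c)\lhd b=a\succ(c\lhd b)=(a\lhd b+a\rhd b)\succ c$; $a\rhd(b\succ c)=(a\lhd b+a\rhd b)\succ c+b\succ(a\rhd c)$; $c\lhd(a\succ b+b\succ a)=b\succ(c\lhd a)+a\succ(c\lhd b)$. Pre-PGD-algebra $(A,\lhd,\rhd,\succ,\diamond)$: $(A,\lhd,\rhd,\succ)$ is a pre-differential Novikov-Poisson algebra, $(A,\lhd,\rhd,\diamond)$ a pre-GD-algebra and $(A,\diamond,\succ)$ a pre-Poisson algebra. All identities are for all $a,b,c\in A$. *)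

theory Defs
  imports "HOL-Computational_Algebra.Polynomial"
begin

definition bilinear_map ::
  "('k::field \<Rightarrow> 'a::ab_group_add \<Rightarrow> 'a) \<Rightarrow> ('k \<Rightarrow> 'b::ab_group_add \<Rightarrow> 'b) \<Rightarrow> ('a \<Rightarrow> 'a \<Rightarrow> 'b) \<Rightarrow> bool"
  where "bilinear_map s t f \<longleftrightarrow>
    (\<forall>a. Vector_Spaces.linear s t (f a)) \<and> (\<forall>b. Vector_Spaces.linear s t (\<lambda>a. f a b))"


section \<open>Algebras over a field\<close>

locale zinbiel_algebra = vector_space scale
  for scale :: "'k::field_char_0 \<Rightarrow> 'a::ab_group_add \<Rightarrow> 'a" +
  fixes zb :: "'a \<Rightarrow> 'a \<Rightarrow> 'a" (infixl "\<succ>" 70)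
  assumes zinbiel_bilinear: "bilinear_map scale scale (\<succ>)"
    and zinbiel: "a \<succ> (b \<succ> c) = (b \<succ> a + a \<succ> b) \<succ> c"

locale left_symmetric_algebra = vector_space scale
  for scale :: "'k::field_char_0 \<Rightarrow> 'a::ab_group_add \<Rightarrow> 'a" +
  fixes ls :: "'a \<Rightarrow> 'a \<Rightarrow> 'a" (infixl "\<diamond>" 70)
  assumes left_symmetric_bilinear: "bilinear_map scale scale (\<diamond>)"
    and left_symmetric: "(a \<diamond> b) \<diamond> c - a \<diamond> (b \<diamond> c) = (b \<diamond> a) \<diamond> c - b \<diamond> (a \<diamond> c)"

locale pre_novikov_algebra = vector_space scale
  for scale :: "'k::field_char_0 \<Rightarrow> 'a::ab_group_add \<Rightarrow> 'a" +
  fixes lhd :: "'a \<Rightarrow> 'a \<Rightarrow> 'a" (infixl "\<lhd>" 70)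
    and rhd :: "'a \<Rightarrow> 'a \<Rightarrow> 'a" (infixl "\<rhd>" 70)
  assumes lhd_bilinear: "bilinear_map scale scale (\<lhd>)"
    and rhd_bilinear: "bilinear_map scale scale (\<rhd>)"
    and pre_novikov_1: "a \<rhd> (b \<rhd> c) =
      (a \<rhd> b + a \<lhd> b) \<rhd> c + b \<rhd> (a \<rhd> c) - (b \<rhd> a + b \<lhd> a) \<rhd> c"
    and pre_novikov_2: "a \<rhd> (b \<lhd> c) =
      (a \<rhd> b) \<lhd> c + b \<lhd> (a \<lhd> c + a \<rhd> c) - (b \<lhd> a) \<lhd> c"
    and pre_novikov_3: "(a \<lhd> b + a \<rhd> b) \<rhd> c = (a \<rhd> c) \<lhd> b"
    and pre_novikov_4: "(a \<lhd> b) \<lhd> c = (a \<lhd> c) \<lhd> b"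

locale pre_gd_algebra =
  pre_novikov_algebra scale lhd rhd + left_symmetric_algebra scale ls
  for scale :: "'k::field_char_0 \<Rightarrow> 'a::ab_group_add \<Rightarrow> 'a"
    and lhd :: "'a \<Rightarrow> 'a \<Rightarrow> 'a" (infixl "\<lhd>" 70)
    and rhd :: "'a \<Rightarrow> 'a \<Rightarrow> 'a" (infixl "\<rhd>" 70)
    and ls :: "'a \<Rightarrow> 'a \<Rightarrow> 'a" (infixl "\<diamond>" 70) +
  assumes pre_gd_1: "c \<lhd> (a \<diamond> b - b \<diamond> a) - a \<diamond> (c \<lhd> b) - (b \<diamond> c) \<lhd> a =
      - (b \<diamond> (c \<lhd> a)) - (a \<diamond> c) \<lhd> b"
    and pre_gd_2: "(a \<diamond> b - b \<diamond> a) \<rhd> c + (a \<lhd> b + a \<rhd> b) \<diamond> c =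
      a \<rhd> (b \<diamond> c) - b \<diamond> (a \<rhd> c) + (a \<diamond> c) \<lhd> b"

locale pre_poisson_algebra =
  left_symmetric_algebra scale ls + zinbiel_algebra scale zb
  for scale :: "'k::field_char_0 \<Rightarrow> 'a::ab_group_add \<Rightarrow> 'a"
    and ls :: "'a \<Rightarrow> 'a \<Rightarrow> 'a" (infixl "\<diamond>" 70)
    and zb :: "'a \<Rightarrow> 'a \<Rightarrow> 'a" (infixl "\<succ>" 70) +
  assumes pre_poisson_1: "(a \<diamond> b - b \<diamond> a) \<succ> c = a \<diamond> (b \<succ> c) - b \<succ> (a \<diamond> c)"
    and pre_poisson_2: "(a \<succ> b + b \<succ> a) \<diamond> c = a \<succ> (b \<diamond> c) + b \<succ> (a \<diamond> c)"

locale pre_differential_novikov_poisson_algebra =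
  pre_novikov_algebra scale lhd rhd + zinbiel_algebra scale zb
  for scale :: "'k::field_char_0 \<Rightarrow> 'a::ab_group_add \<Rightarrow> 'a"
    and lhd :: "'a \<Rightarrow> 'a \<Rightarrow> 'a" (infixl "\<lhd>" 70)
    and rhd :: "'a \<Rightarrow> 'a \<Rightarrow> 'a" (infixl "\<rhd>" 70)
    and zb :: "'a \<Rightarrow> 'a \<Rightarrow> 'a" (infixl "\<succ>" 70) +
  assumes pre_dnp_1: "(a \<succ> b + b \<succ> a) \<rhd> c = a \<succ> (b \<rhd> c)"
    and pre_dnp_2: "(a \<succ> c) \<lhd> b = a \<succ> (c \<lhd> b)"
    and pre_dnp_3: "a \<succ> (c \<lhd> b) = (a \<lhd> b + a \<rhd> b) \<succ> c"
    and pre_dnp_4: "a \<rhd> (b \<succ> c) = (a \<lhd> b + a \<rhd> b) \<succ> c + b \<succ> (a \<rhd> c)"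
    and pre_dnp_5: "c \<lhd> (a \<succ> b + b \<succ> a) = b \<succ> (c \<lhd> a) + a \<succ> (c \<lhd> b)"

locale pre_pgd_algebra =
  pre_differential_novikov_poisson_algebra scale lhd rhd zb +
  pre_gd_algebra scale lhd rhd ls +
  pre_poisson_algebra scale ls zb
  for scale :: "'k::field_char_0 \<Rightarrow> 'a::ab_group_add \<Rightarrow> 'a"
    and lhd :: "'a \<Rightarrow> 'a \<Rightarrow> 'a"
    and rhd :: "'a \<Rightarrow> 'a \<Rightarrow> 'a"
    and zb :: "'a \<Rightarrow> 'a \<Rightarrow> 'a"
    and ls :: "'a \<Rightarrow> 'a \<Rightarrow> 'a"


section \<open>Polynomials with coefficients in a module\<close>

text \<open>
  For an additive group \<open>M\<close>, the type of polynomials over \<open>M\<close> is used for \<open>M[\<lambda>]\<close>. The map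
  \<open>poly_at T f\<close> sends \<open>\<Sum>k. \<nu>^k c_k\<close> to \<open>\<Sum>k. T^k (f c_k)\<close>: it replaces the variable \<open>\<nu>\<close> by the
  operator \<open>T\<close> after applying the additive map \<open>f\<close> to the coefficients.
\<close>

definition poly_at :: "('q \<Rightarrow> 'q) \<Rightarrow> ('m::zero \<Rightarrow> 'q::comm_monoid_add) \<Rightarrow> 'm poly \<Rightarrow> 'q"
  where "poly_at T f x = (\<Sum>k\<le>degree x. (T ^^ k) (f (coeff x k)))"

lemma poly_at_const: "poly_at T f [:a:] = f a"
  by (simp add: poly_at_def)

lemma poly_at_bound:
  fixes f :: "'m::zero \<Rightarrow> 'q::ab_group_add"
  assumes "\<And>x y. T (x + y) = T x + T y" "f 0 = 0" "degree x \<le> n"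
  shows "poly_at T f x = (\<Sum>k\<le>n. (T ^^ k) (f (coeff x k)))"
proof -
  have T0: "T 0 = 0" using assms(1)[of 0 0] by simp
  have Tk: "(T ^^ k) 0 = 0" for k by (induction k) (auto simp: T0)
  show ?thesis unfolding poly_at_def
    by (rule sum.mono_neutral_left) (use assms in \<open>auto simp: Tk coeff_eq_0\<close>)
qed

lemma poly_at_pCons_0:
  fixes f :: "'m::zero \<Rightarrow> 'q::ab_group_add"
  assumes "\<And>x y. T (x + y) = T x + T y" "f 0 = 0"
  shows "poly_at T f (pCons 0 x) = T (poly_at T f x)"
proof -
  have T0: "T 0 = 0" using assms(1)[of 0 0] by simp
  have Ts: "T (sum g A) = (\<Sum>k\<in>A. T (g k))" for g and A :: "nat set"
    by (induction A rule: infinite_finite_induct) (auto simp: T0 assms)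
  have "poly_at T f (pCons 0 x) = (\<Sum>k\<le>Suc (degree x). (T ^^ k) (f (coeff (pCons 0 x) k)))"
    by (rule poly_at_bound) (use assms degree_pCons_le in auto)
  also have "\<dots> = T (poly_at T f x)"
    by (subst sum.atMost_Suc_shift) (simp add: assms poly_at_def Ts)
  finally show ?thesis .
qed

lemma poly_at_add:
  fixes f :: "'m::ab_group_add \<Rightarrow> 'q::ab_group_add"
  assumes T: "\<And>x y. T (x + y) = T x + T y" and f: "\<And>x y. f (x + y) = f x + f y"
  shows "poly_at T f (x + y) = poly_at T f x + poly_at T f y"
proof -
  have f0: "f 0 = 0" using f[of 0 0] by simp
  have Tk: "(T ^^ k) (x + y) = (T ^^ k) x + (T ^^ k) y" for k x y
    by (induction k) (auto simp: T)
  let ?n = "max (degree x) (degree y)"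
  have "degree (x + y) \<le> ?n" by (rule degree_add_le_max)
  thus ?thesis
    by (simp add: poly_at_bound[where n = ?n and T = T and f = f, OF T f0] f Tk sum.distrib)
qed


section \<open>Conformal algebras\<close>

text \<open>
  A \<open>k[\<partial>]\<close>-module is a module over the ring of polynomials over \<open>k\<close>, where \<open>\<partial>\<close> is the
  indeterminate \<open>[:0, 1:]\<close> and the scalar \<open>c\<close> is the constant polynomial \<open>[:c:]\<close>.
  A \<open>\<lambda>\<close>-product on \<open>P\<close> takes values in \<open>P[\<lambda>]\<close>. There \<open>\<lambda>\<close> acts as \<open>pCons 0\<close>, and \<open>\<partial>\<close> and \<open>k\<close> act
  coefficientwise.
\<close>

locale lambda_product = module act
  for act :: "'k::field_char_0 poly \<Rightarrow> 'p::ab_group_add \<Rightarrow> 'p" +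
  fixes lp :: "'p \<Rightarrow> 'p \<Rightarrow> 'p poly"
  assumes bilinear: "bilinear_map (\<lambda>c. act [:c:]) (\<lambda>c. map_poly (act [:c:])) lp"
    and sesquilinear_left: "lp (act [:0, 1:] a) b = - pCons 0 (lp a b)"
    and sesquilinear_right:
      "lp a (act [:0, 1:] b) = map_poly (act [:0, 1:]) (lp a b) + pCons 0 (lp a b)"

text \<open>\<open>b *\<^sub>\<nu> a\<close> evaluated at \<open>\<nu> = - \<lambda> - \<partial>\<close>, as an element of \<open>P[\<lambda>]\<close>\<close>

definition lp_opp ::
  "('k::field_char_0 poly \<Rightarrow> 'p::ab_group_add \<Rightarrow> 'p) \<Rightarrow> ('p \<Rightarrow> 'p \<Rightarrow> 'p poly) \<Rightarrow> 'p \<Rightarrow> 'p \<Rightarrow> 'p poly"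
  where "lp_opp act lp b a =
    poly_at (\<lambda>x. - pCons 0 x - map_poly (act [:0, 1:]) x) (\<lambda>c. [:c:]) (lp b a)"

text \<open>
  \<open>P[\<lambda>,\<mu>]\<close> is \<open>(P[\<mu>])[\<lambda>]\<close>: the outer variable is \<open>\<lambda>\<close>, the inner one is \<open>\<mu>\<close>.
\<close>

definition mult_lam :: "'p::ab_group_add poly poly \<Rightarrow> 'p poly poly"
  where "mult_lam x = pCons 0 x"

definition mult_mu :: "'p::ab_group_add poly poly \<Rightarrow> 'p poly poly"
  where "mult_mu x = map_poly (pCons 0) x"

definition mult_lam_mu :: "'p::ab_group_add poly poly \<Rightarrow> 'p poly poly"
  where "mult_lam_mu x = mult_lam x + mult_mu x"

text \<open>
  Iterated products in \<open>P[\<lambda>,\<mu>]\<close>. In \<open>lp_right lp S a T y\<close> and \<open>lp_left lp T y S c\<close> the polynomial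
  \<open>y = \<Sum>k. \<nu>^k y_k\<close> is read at \<open>\<nu> = T\<close>, and the outer product has parameter \<open>S\<close>; they are
  \<open>a *_S y(T) = \<Sum>k. T^k (a *_S y_k)\<close> and \<open>y(T) *_S c = \<Sum>k. T^k (y_k *_S c)\<close>.
\<close>

definition lp_right ::
  "('p::ab_group_add \<Rightarrow> 'p \<Rightarrow> 'p poly) \<Rightarrow> ('p poly poly \<Rightarrow> 'p poly poly) \<Rightarrow> 'p \<Rightarrow>
   ('p poly poly \<Rightarrow> 'p poly poly) \<Rightarrow> 'p poly \<Rightarrow> 'p poly poly"
  where "lp_right lp S a T y = poly_at T (\<lambda>u. poly_at S (\<lambda>v. [:[:v:]:]) (lp a u)) y"

definition lp_left ::
  "('p::ab_group_add \<Rightarrow> 'p \<Rightarrow> 'p poly) \<Rightarrow> ('p poly poly \<Rightarrow> 'p poly poly) \<Rightarrow> 'p poly \<Rightarrow>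
   ('p poly poly \<Rightarrow> 'p poly poly) \<Rightarrow> 'p \<Rightarrow> 'p poly poly"
  where "lp_left lp T y S c = poly_at T (\<lambda>u. poly_at S (\<lambda>v. [:[:v:]:]) (lp u c)) y"

locale left_symmetric_conformal_algebra = lambda_product act circ
  for act :: "'k::field_char_0 poly \<Rightarrow> 'p::ab_group_add \<Rightarrow> 'p"
    and circ :: "'p \<Rightarrow> 'p \<Rightarrow> 'p poly" +
  assumes left_symmetric_conformal:
    "lp_right circ mult_lam a mult_mu (circ b c) - lp_left circ mult_lam (circ a b) mult_lam_mu c =
     lp_right circ mult_mu b mult_lam (circ a c) - lp_left circ mult_mu (circ b a) mult_lam_mu c"

locale zinbiel_conformal_algebra = lambda_product act succ
  for act :: "'k::field_char_0 poly \<Rightarrow> 'p::ab_group_add \<Rightarrow> 'p"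
    and succ :: "'p \<Rightarrow> 'p \<Rightarrow> 'p poly" +
  assumes zinbiel_conformal:
    "lp_right succ mult_lam a mult_mu (succ b c) =
     lp_left succ mult_lam (succ a b + lp_opp act succ b a) mult_lam_mu c"

locale pre_poisson_conformal_algebra =
  circ: left_symmetric_conformal_algebra act circ + succ: zinbiel_conformal_algebra act succ
  for act :: "'k::field_char_0 poly \<Rightarrow> 'p::ab_group_add \<Rightarrow> 'p"
    and circ :: "'p \<Rightarrow> 'p \<Rightarrow> 'p poly"
    and succ :: "'p \<Rightarrow> 'p \<Rightarrow> 'p poly" +
  assumes pre_poisson_conformal_1:
    "lp_left succ mult_lam (circ a b - lp_opp act circ b a) mult_lam_mu c =
     lp_right circ mult_lam a mult_mu (succ b c) - lp_right succ mult_mu b mult_lam (circ a c)"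
    and pre_poisson_conformal_2:
    "lp_left circ mult_lam (succ a b + lp_opp act succ b a) mult_lam_mu c =
     lp_right succ mult_lam a mult_mu (circ b c) + lp_right succ mult_mu b mult_lam (circ a c)"


section \<open>The free module over \<open>k[\<partial>]\<close>\<close>

text \<open>
  The free module \<open>k[\<partial>] \<otimes> A\<close> is \<open>A[\<partial>]\<close>, i.e. polynomials over \<open>A\<close>, with
  \<open>\<partial>^i \<otimes> a\<close> being \<open>monom a i\<close>; in particular \<open>a\<close> in \<open>A\<close> is identified with \<open>[:a:]\<close>.
  The action of \<open>p = \<Sum>k. c_k \<partial>^k\<close> is \<open>x \<mapsto> \<Sum>k. \<partial>^k (c_k x)\<close>.
\<close>

definition free_act ::
  "('k::field_char_0 \<Rightarrow> 'a::ab_group_add \<Rightarrow> 'a) \<Rightarrow> 'k poly \<Rightarrow> 'a poly \<Rightarrow> 'a poly"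
  where "free_act scale p x = poly_at (pCons 0) (\<lambda>c. map_poly (scale c) x) p"

lemma free_act_const: "free_act scale [:c:] x = map_poly (scale c) x"
  by (simp add: free_act_def poly_at_const)

lemma free_act_partial:
  assumes "vector_space scale"
  shows "free_act scale [:0, 1:] x = pCons 0 x"
proof -
  interpret vector_space scale by fact
  have "map_poly (scale 1) x = x" "map_poly (scale 0) x = 0"
    by (auto simp: poly_eq_iff coeff_map_poly)
  thus ?thesis by (simp add: free_act_def poly_at_def)
qed

lemma module_free_act:
  assumes "vector_space scale"
  shows "module (free_act scale)"
proof -
  interpret vector_space scale by fact
  let ?A = "free_act scale"
  have m_add: "map_poly (scale c) (x + y) = map_poly (scale c) x + map_poly (scale c) y" for c x y
    by (auto simp: poly_eq_iff coeff_map_poly scale_right_distrib)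
  have m_add2: "map_poly (scale (c + d)) x = map_poly (scale c) x + map_poly (scale d) x" for c d x
    by (auto simp: poly_eq_iff coeff_map_poly scale_left_distrib)
  have m0: "map_poly (scale 0) x = 0" for x
    by (auto simp: poly_eq_iff coeff_map_poly)
  have A_addl: "?A (p + q) x = ?A p x + ?A q x" for p q x
    unfolding free_act_def by (rule poly_at_add) (auto simp: m_add2)
  have A_shift: "?A (pCons 0 p) x = pCons 0 (?A p x)" for p x
    unfolding free_act_def by (rule poly_at_pCons_0) (auto simp: m0)
  have A0: "?A 0 x = 0" for x using A_addl[of 0 0 x] by simp
  have A_pCons: "?A (pCons c p) x = map_poly (scale c) x + pCons 0 (?A p x)" for c p x
    using A_addl[of "[:c:]" "pCons 0 p" x] by (simp add: A_shift free_act_const)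
  have A_addr: "?A p (x + y) = ?A p x + ?A p y" for p x y
    by (induction p) (auto simp: A0 A_pCons m_add)
  have A_sm: "?A (smult c q) x = map_poly (scale c) (?A q x)" for c q x
    by (induction q)
      (auto simp: A0 A_pCons m_add poly_eq_iff coeff_map_poly coeff_pCons scale_right_distrib split: nat.split)
  have A_mult: "?A p (?A q x) = ?A (p * q) x" for p q x
    by (induction p) (auto simp: A0 A_pCons A_addl A_sm A_shift m0)
  have "?A 1 x = x" for x
    by (simp add: one_pCons free_act_const poly_eq_iff coeff_map_poly)
  thus ?thesis by unfold_locales (auto simp: A_addl A_addr A_mult)
qed

text \<open>
  The extension by sesquilinearity of \<open>f : A \<times> A \<rightarrow> A[\<partial>][\<lambda>]\<close>:
  \<open>(\<Sum>i. \<partial>^i a_i) *\<^sub>\<lambda> (\<Sum>j. \<partial>^j b_j) = \<Sum>i j. (- \<lambda>)^i (\<partial> + \<lambda>)^j f a_i b_j\<close>.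
  Values of \<open>f\<close> are polynomials with outer variable \<open>\<lambda>\<close> and inner variable \<open>\<partial>\<close>.
\<close>

definition sesquilinear_ext ::
  "('a::ab_group_add \<Rightarrow> 'a \<Rightarrow> 'a poly poly) \<Rightarrow> 'a poly \<Rightarrow> 'a poly \<Rightarrow> 'a poly poly"
  where "sesquilinear_ext f x y =
    poly_at (\<lambda>z. - pCons 0 z)
      (\<lambda>a. poly_at (\<lambda>z. map_poly (pCons 0) z + pCons 0 z) (\<lambda>b. f a b) y) x"

lemma sesquilinear_ext_const: "sesquilinear_ext f [:a:] [:b:] = f a b"
  by (simp add: sesquilinear_ext_def poly_at_const)

lemma sesquilinear_ext_left:
  assumes "\<And>b. f 0 b = 0"
  shows "sesquilinear_ext f (pCons 0 x) y = - pCons 0 (sesquilinear_ext f x y)"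
proof -
  have "((\<lambda>z. map_poly (pCons 0) z + pCons 0 z) ^^ k) 0 = (0::'a poly poly)" for k
    by (induction k) auto
  thus ?thesis
    unfolding sesquilinear_ext_def by (intro poly_at_pCons_0) (auto simp: assms poly_at_def)
qed

lemma sesquilinear_ext_right:
  assumes "\<And>a. f a 0 = 0"
  shows "sesquilinear_ext f x (pCons 0 y) =
    map_poly (pCons 0) (sesquilinear_ext f x y) + pCons 0 (sesquilinear_ext f x y)"
proof -
  let ?S = "\<lambda>z::'a poly poly. map_poly (pCons 0) z + pCons 0 z"
  let ?T = "\<lambda>z::'a poly poly. - pCons 0 z"
  have S_add: "?S (u + v) = ?S u + ?S v" for u v
    by (auto simp: poly_eq_iff coeff_map_poly coeff_pCons split: nat.split)
  have S_T: "?S (?T u) = ?T (?S u)" for u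
    by (auto simp: poly_eq_iff coeff_map_poly coeff_pCons split: nat.split)
  have S_Tk: "?S ((?T ^^ k) u) = (?T ^^ k) (?S u)" for k u
    by (induction k) (use S_T in \<open>auto simp del: minus_pCons\<close>)
  have S_sum: "?S (sum g A) = (\<Sum>k\<in>A. ?S (g k))" for g and A :: "nat set"
    by (induction A rule: infinite_finite_induct) (use S_add in \<open>auto\<close>)
  have "poly_at ?S (f a) (pCons 0 y) = ?S (poly_at ?S (f a) y)" for a
    by (rule poly_at_pCons_0) (use S_add assms in auto)
  hence "sesquilinear_ext f x (pCons 0 y) = poly_at ?T (\<lambda>a. ?S (poly_at ?S (f a) y)) x"
    unfolding sesquilinear_ext_def by simp
  also have "\<dots> = ?S (sesquilinear_ext f x y)"
    unfolding sesquilinear_ext_def poly_at_def[of ?T] S_sum S_Tk ..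
  finally show ?thesis .
qed

end

theory Submission
  imports Defs
begin

text \<open>
  Each side of a defining identity of a pre-Poisson conformal algebra is a function \<open>F a b c\<close> with
  values in \<open>P[\<lambda>,\<mu>]\<close> that is additive in each argument and obeys the same three rules: \<open>\<partial>\<close> in the first argument
  acts as \<open>- \<lambda>\<close>, in the second as \<open>- \<mu>\<close>, and in the third as \<open>\<partial> + \<lambda> + \<mu>\<close>
  (\<open>trisesquilinear_lam_mu\<close>). These rules determine \<open>F\<close> on the free module \<open>A[\<partial>]\<close> from its values
  on \<open>A\<close>, so an identity holds on \<open>P\<close> as soon as it holds on generators
  (\<open>trisesquilinear_eq_iff\<close>).

  On generators both sides are polynomials of degree at most two in \<open>\<partial>\<close>, \<open>\<lambda>\<close>, \<open>\<mu>\<close>. They are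
  compared in the variables \<open>D = \<partial> + \<lambda> + \<mu>\<close>, \<open>\<lambda>\<close>, \<open>\<mu>\<close> rather than in \<open>\<partial>\<close>, \<open>\<lambda>\<close>, \<open>\<mu>\<close>. The reason is
  that \<open>D\<close> is the operator by which \<open>\<partial>\<close> in the third argument acts, and that it is invariant under
  the exchange of \<open>\<lambda>\<close> and \<open>\<mu>\<close>. In these coordinates the equation of every
  coefficient is, up to rearranging and renaming, one of the equalities that the axioms of a
  pre-PGD-algebra assert:

  \<^item> left-symmetry of \<open>\<circ>\<^sub>\<lambda>\<close>: the quadratic part gives the four pre-Novikov axioms, the linear part
    the two compatibility axioms of a pre-GD-algebra, and the constant part left-symmetry of \<open>\<diamond>\<close>
    (\<open>left_symmetric_conformal_iff_pre_gd\<close>);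
  \<^item> the Zinbiel identity has only a constant part (\<open>zinbiel_conformal_iff_zinbiel\<close>);
  \<^item> in the two mixed identities the linear part gives the axioms that relate \<open>\<lhd>\<close> and \<open>\<rhd>\<close> to
    \<open>\<succ>\<close>, and the constant part the two compatibility axioms of a pre-Poisson algebra
    (\<open>pre_poisson_conformal_1_iff\<close>, \<open>pre_poisson_conformal_2_iff\<close>).

  The product \<open>\<succ>\<^sub>\<lambda>\<close> is the instance \<open>\<lhd> = \<rhd> = 0\<close>, \<open>\<diamond> = \<succ>\<close> of \<open>\<circ>\<^sub>\<lambda>\<close>, so the iterated
  products of both kinds are evaluated by the same two formulas (\<open>lp_right_affine\<close>,
  \<open>lp_left_affine\<close>).
\<close>

section \<open>Substitution into polynomials over a group\<close>

lemma additive_map_poly: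
  fixes f :: "'a::ab_group_add \<Rightarrow> 'b::ab_group_add"
  assumes "additive f"
  shows "additive (map_poly f)"
  using assms by (auto simp: additive_def poly_eq_iff coeff_map_poly additive.zero[OF assms])

lemma map_poly_pCons_additive:
  fixes f :: "'a::ab_group_add \<Rightarrow> 'b::ab_group_add"
  assumes "additive f"
  shows "map_poly f (pCons a x) = pCons (f a) (map_poly f x)"
  by (simp add: additive.zero[OF assms] map_poly_pCons)

lemma additive_pCons_0: "additive (pCons (0::'a::ab_group_add))"
  by (simp add: additive_def)

lemma additive_const_poly: "additive (\<lambda>a::'a::ab_group_add. [:a:])"
  by (simp add: additive_def)

lemma additive_sum_fun:
  fixes f g :: "'a::ab_group_add \<Rightarrow> 'b::ab_group_add"
  assumes "additive f" "additive g"
  shows "additive (\<lambda>x. f x + g x)"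
  using assms by (simp add: additive_def algebra_simps)

lemma additive_compose_fun:
  assumes "additive f" "additive g"
  shows "additive (\<lambda>x. f (g x))"
  using assms by (simp add: additive_def)

lemma additive_poly_at:
  fixes f :: "'m::ab_group_add \<Rightarrow> 'q::ab_group_add"
  assumes "additive T" "additive f"
  shows "additive (poly_at T f)"
  using assms by (simp add: additive_def poly_at_add)

lemma poly_at_shift:
  fixes f :: "'m::ab_group_add \<Rightarrow> 'q::ab_group_add"
  assumes "additive T" "additive f"
  shows "poly_at T f (pCons 0 x) = T (poly_at T f x)"
  using assms by (intro poly_at_pCons_0) (auto simp: additive.add additive.zero)

lemma poly_at_pCons:
  fixes f :: "'m::ab_group_add \<Rightarrow> 'q::ab_group_add"
  assumes "additive T" "additive f"
  shows "poly_at T f (pCons a x) = f a + T (poly_at T f x)"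
proof -
  have "pCons a x = [:a:] + pCons 0 x" by simp
  thus ?thesis
    by (simp only: additive.add[OF additive_poly_at[OF assms]] poly_at_const poly_at_shift[OF assms])
qed

lemma poly_at_zero:
  fixes f :: "'m::ab_group_add \<Rightarrow> 'q::ab_group_add"
  assumes "additive f"
  shows "poly_at T f 0 = 0"
  by (simp add: poly_at_def additive.zero[OF assms])

lemma poly_at_map_poly:
  fixes f :: "'m::ab_group_add \<Rightarrow> 'q::ab_group_add" and g :: "'n::ab_group_add \<Rightarrow> 'm"
  assumes T: "additive T" and f: "additive f" and g: "additive g"
  shows "poly_at T f (map_poly g x) = poly_at T (\<lambda>a. f (g a)) x"
proof -
  have fg: "additive (\<lambda>a. f (g a))" by (rule additive_compose_fun[OF f g])
  show ?thesis
    by (induction x) (simp_all add: poly_at_zero f fg map_poly_pCons_additive g poly_at_pCons T)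
qed

lemma poly_at_commute:
  fixes f :: "'m::ab_group_add \<Rightarrow> 'q::ab_group_add" and g :: "'q \<Rightarrow> 'q"
  assumes T: "additive T" and f: "additive f" and g: "additive g"
    and gT: "\<And>x. g (T x) = T (g x)"
  shows "poly_at T (\<lambda>a. g (f a)) x = g (poly_at T f x)"
proof -
  have gf: "additive (\<lambda>a. g (f a))" by (rule additive_compose_fun[OF g f])
  show ?thesis
    by (induction x)
      (simp_all add: poly_at_zero f gf poly_at_pCons T gT additive.add[OF g] additive.zero[OF g])
qed

lemma poly_at_sum_fun:
  fixes f g :: "'m::ab_group_add \<Rightarrow> 'q::ab_group_add"
  assumes T: "additive T" and f: "additive f" and g: "additive g"
  shows "poly_at T (\<lambda>a. f a + g a) x = poly_at T f x + poly_at T g x"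
  by (induction x)
    (simp_all add: poly_at_zero f g additive_sum_fun poly_at_pCons T additive.add[OF T] algebra_simps)

lemma bilinear_map_additive_left:
  assumes "bilinear_map s t f"
  shows "additive (\<lambda>a. f a b)"
proof -
  have "module_hom s t (\<lambda>a. f a b)"
    using assms unfolding bilinear_map_def Vector_Spaces.linear_def by blast
  from module_hom.add[OF this] show ?thesis by (simp add: additive_def)
qed

lemma bilinear_map_additive_right:
  assumes "bilinear_map s t f"
  shows "additive (f a)"
proof -
  have "module_hom s t (f a)"
    using assms unfolding bilinear_map_def Vector_Spaces.linear_def by blast
  from module_hom.add[OF this] show ?thesis by (simp add: additive_def)
qed

section \<open>Sesquilinear products\<close>

text \<open>
  The part of a \<open>\<lambda>\<close>-product that determines it on a free module from its values on generators;
  \<open>d\<close> is the action of \<open>\<partial>\<close>.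
\<close>

locale sesquilinear_product =
  fixes d :: "'p::ab_group_add \<Rightarrow> 'p" and lp :: "'p \<Rightarrow> 'p \<Rightarrow> 'p poly"
  assumes d_additive: "additive d"
    and left_additive: "additive (\<lambda>a. lp a b)"
    and right_additive: "additive (lp a)"
    and left_shift: "lp (d a) b = - pCons 0 (lp a b)"
    and right_shift: "lp a (d b) = map_poly d (lp a b) + pCons 0 (lp a b)"

lemma (in lambda_product) sesquilinear: "sesquilinear_product (act [:0, 1:]) lp"
proof
  show "act [:0, 1:] (x + y) = act [:0, 1:] x + act [:0, 1:] y" for x y
    by (rule scale_right_distrib)
  show "lp (x + y) b = lp x b + lp y b" for x y b
    by (rule additive.add[OF bilinear_map_additive_left[OF bilinear]])
  show "lp a (x + y) = lp a x + lp a y" for x y a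
    by (rule additive.add[OF bilinear_map_additive_right[OF bilinear]])
qed (use sesquilinear_left sesquilinear_right in auto)

lemma sesquilinear_product_add:
  assumes "sesquilinear_product d p" "sesquilinear_product d q"
  shows "sesquilinear_product d (\<lambda>a b. p a b + q a b)"
proof -
  interpret p: sesquilinear_product d p by fact
  interpret q: sesquilinear_product d q by fact
  show ?thesis
    by unfold_locales
      (simp_all add: additive.add[OF p.d_additive] additive.add[OF p.left_additive]
        additive.add[OF q.left_additive] additive.add[OF p.right_additive]
        additive.add[OF q.right_additive] p.left_shift q.left_shift p.right_shift q.right_shift
        additive.add[OF additive_map_poly[OF p.d_additive]] algebra_simps)
qed

lemma sesquilinear_product_diff:
  assumes "sesquilinear_product d p" "sesquilinear_product d q"
  shows "sesquilinear_product d (\<lambda>a b. p a b - q a b)"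
proof -
  interpret p: sesquilinear_product d p by fact
  interpret q: sesquilinear_product d q by fact
  show ?thesis
    by unfold_locales
      (simp_all add: additive.add[OF p.d_additive] additive.add[OF p.left_additive]
        additive.add[OF q.left_additive] additive.add[OF p.right_additive]
        additive.add[OF q.right_additive] p.left_shift q.left_shift p.right_shift q.right_shift
        additive.diff[OF additive_map_poly[OF p.d_additive]] algebra_simps)
qed

text \<open>
  The substitution \<open>\<nu> = - \<lambda> - \<partial>\<close> exchanges the two sesquilinearity rules: \<open>\<nu> + \<partial>\<close> becomes
  \<open>- \<lambda>\<close>, and \<open>- \<nu>\<close> becomes \<open>\<partial> + \<lambda>\<close>. Hence \<open>b *\<^sub>\<nu> a\<close> at this \<open>\<nu>\<close> is sesquilinear in \<open>(a, b)\<close>.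
\<close>

lemma sesquilinear_product_opp:
  assumes "sesquilinear_product (act [:0, 1:]) lp"
  shows "sesquilinear_product (act [:0, 1:]) (\<lambda>a b. lp_opp act lp b a)"
proof -
  let ?d = "act [:0, 1:]"
  interpret sesquilinear_product ?d lp by fact
  \<comment> \<open>\<open>R\<close> is the operator \<open>- \<lambda> - \<partial>\<close>, and \<open>E\<close> substitutes it for \<open>\<nu>\<close>.\<close>
  define D where "D = map_poly ?d"
  define R where "R = (\<lambda>x. - pCons 0 x - D x)"
  define E where "E = poly_at R (\<lambda>c. [:c:])"
  have D: "additive D" unfolding D_def by (rule additive_map_poly[OF d_additive])
  have R: "additive R" unfolding R_def
    using D by (simp add: additive_def algebra_simps)
  have D_pCons: "D (pCons c x) = pCons (?d c) (D x)" for c x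
    unfolding D_def by (rule map_poly_pCons_additive[OF d_additive])
  have DR: "D (R x) = R (D x)" for x
    unfolding R_def
    by (simp add: additive.diff[OF D] additive.minus[OF D] D_pCons additive.zero[OF d_additive]
        del: minus_pCons)
  have E: "additive E" unfolding E_def by (rule additive_poly_at[OF R additive_const_poly])
  have E_shift: "E (pCons 0 x) = R (E x)" for x
    unfolding E_def by (rule poly_at_shift[OF R additive_const_poly])
  have E_D: "E (D x) = D (E x)" for x
    unfolding E_def
    using poly_at_map_poly[OF R additive_const_poly d_additive, of x]
      poly_at_commute[where f = "\<lambda>c. [:c:]", OF R additive_const_poly D DR, of x]
    by (simp add: D_pCons additive.zero[OF D] flip: D_def)
  have opp: "lp_opp act lp b a = E (lp b a)" for a b
    unfolding lp_opp_def E_def R_def D_def ..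
  show ?thesis
  proof (rule sesquilinear_product.intro)
    show "additive (\<lambda>a. lp_opp act lp b a)" for b
      unfolding opp by (rule additive_compose_fun[OF E right_additive])
    show "additive (\<lambda>b. lp_opp act lp b a)" for a
      unfolding opp by (rule additive_compose_fun[OF E left_additive])
    show "lp_opp act lp b (?d a) = - pCons 0 (lp_opp act lp b a)" for a b
      by (simp add: opp right_shift additive.add[OF E] E_shift R_def E_D flip: D_def)
    show "lp_opp act lp (?d b) a =
        map_poly ?d (lp_opp act lp b a) + pCons 0 (lp_opp act lp b a)" for a b
      by (simp add: opp left_shift additive.minus[OF E] E_shift R_def flip: D_def del: minus_pCons)
  qed (rule d_additive)
qed

section \<open>Iterated products\<close>

text \<open>
  The behaviour of \<open>a *\<^sub>S (b *\<^sub>T c)\<close> and \<open>(a *\<^sub>S b) *\<^sub>S\<^sub>+\<^sub>T c\<close> under \<open>\<partial>\<close>, for commuting operators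
  \<open>S\<close> and \<open>T\<close> in place of the parameters \<open>\<lambda>\<close> and \<open>\<mu>\<close>. Keeping \<open>S\<close> and \<open>T\<close> abstract serves
  both \<open>(\<lambda>, \<mu>)\<close> and \<open>(\<mu>, \<lambda>)\<close>.
\<close>

locale trisesquilinear =
  fixes d :: "'p::ab_group_add \<Rightarrow> 'p" and S T :: "'p poly poly \<Rightarrow> 'p poly poly"
    and F :: "'p \<Rightarrow> 'p \<Rightarrow> 'p \<Rightarrow> 'p poly poly"
  assumes additive_1: "additive (\<lambda>a. F a b c)"
    and additive_2: "additive (\<lambda>b. F a b c)"
    and additive_3: "additive (\<lambda>c. F a b c)"
    and shift_1: "F (d a) b c = - S (F a b c)"
    and shift_2: "F a (d b) c = - T (F a b c)"
    and shift_3: "F a b (d c) = map_poly (map_poly d) (F a b c) + S (F a b c) + T (F a b c)"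

lemma trisesquilinear_swap:
  assumes "trisesquilinear d S T F"
  shows "trisesquilinear d T S (\<lambda>a b c. F b a c)"
  using assms unfolding trisesquilinear_def by (simp add: algebra_simps)

lemma trisesquilinear_add:
  assumes F: "trisesquilinear d S T F" and G: "trisesquilinear d S T G"
    and d: "additive d" and S: "additive S" and T: "additive T"
  shows "trisesquilinear d S T (\<lambda>a b c. F a b c + G a b c)"
proof -
  have D: "additive (map_poly (map_poly d))" by (intro additive_map_poly d)
  show ?thesis
    using F G unfolding trisesquilinear_def
    by (simp add: additive_sum_fun additive.add[OF S] additive.add[OF T] additive.add[OF D])
qed

lemma trisesquilinear_diff:
  assumes F: "trisesquilinear d S T F" and G: "trisesquilinear d S T G"
    and d: "additive d" and S: "additive S" and T: "additive T"
  shows "trisesquilinear d S T (\<lambda>a b c. F a b c - G a b c)"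
proof -
  have D: "additive (map_poly (map_poly d))" by (intro additive_map_poly d)
  show ?thesis
    using F G unfolding trisesquilinear_def
    by (simp add: additive_def additive.diff[OF S] additive.diff[OF T] additive.diff[OF D])
qed

text \<open>
  Every \<open>x\<close> in \<open>A[\<partial>]\<close> is \<open>a + \<partial> x'\<close> with \<open>x'\<close> of smaller degree, and the shift rules pull the
  \<open>\<partial>\<close> out. Induction in the third, second and first argument reduces to generators.
\<close>

lemma trisesquilinear_eqI:
  fixes F G :: "'a::ab_group_add poly \<Rightarrow> 'a poly \<Rightarrow> 'a poly \<Rightarrow> 'a poly poly poly"
  assumes F: "trisesquilinear (pCons 0) S T F" and G: "trisesquilinear (pCons 0) S T G"
    and eq: "\<And>a b c. F [:a:] [:b:] [:c:] = G [:a:] [:b:] [:c:]"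
  shows "F x y z = G x y z"
proof -
  interpret F: trisesquilinear "pCons 0" S T F by fact
  interpret G: trisesquilinear "pCons 0" S T G by fact
  have split: "pCons a x = [:a:] + pCons 0 x" for a :: 'a and x by simp
  have 1: "F [:a:] [:b:] z = G [:a:] [:b:] z" for a b
  proof (induction z)
    case 0
    show ?case by (simp add: additive.zero[OF F.additive_3] additive.zero[OF G.additive_3])
  next
    case (pCons c z)
    thus ?case
      by (subst (1 2) split) (simp only: additive.add[OF F.additive_3] additive.add[OF G.additive_3]
          F.shift_3 G.shift_3 eq)
  qed
  have 2: "F [:a:] y z = G [:a:] y z" for a
  proof (induction y)
    case 0
    show ?case by (simp add: additive.zero[OF F.additive_2] additive.zero[OF G.additive_2])
  next
    case (pCons c z)
    thus ?case
      by (subst (1 2) split) (simp only: additive.add[OF F.additive_2] additive.add[OF G.additive_2]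
          F.shift_2 G.shift_2 1)
  qed
  show ?thesis
  proof (induction x)
    case 0
    show ?case by (simp add: additive.zero[OF F.additive_1] additive.zero[OF G.additive_1])
  next
    case (pCons c z)
    thus ?case
      by (subst (1 2) split) (simp only: additive.add[OF F.additive_1] additive.add[OF G.additive_1]
          F.shift_1 G.shift_1 2)
  qed
qed

abbreviation param_at :: "('p::ab_group_add poly poly \<Rightarrow> 'p poly poly) \<Rightarrow> 'p poly \<Rightarrow> 'p poly poly"
  where "param_at S \<equiv> poly_at S (\<lambda>v. [:[:v:]:])"

text \<open>
  The operators on \<open>P[\<lambda>,\<mu>]\<close> that may be substituted for a parameter: besides \<open>(\<lambda>, \<mu>)\<close> also
  \<open>(\<lambda> + \<mu>, \<lambda>)\<close>, which occurs in the evaluation of \<open>(a *\<^sub>\<lambda> b) *\<^sub>\<lambda>\<^sub>+\<^sub>\<mu> c\<close>.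
\<close>

locale parameter_pair =
  fixes d :: "'p::ab_group_add \<Rightarrow> 'p" and S T :: "'p poly poly \<Rightarrow> 'p poly poly"
  assumes d: "additive d" and S: "additive S" and T: "additive T"
    and ST: "S (T x) = T (S x)"
    and dS: "map_poly (map_poly d) (S x) = S (map_poly (map_poly d) x)"
    and dT: "map_poly (map_poly d) (T x) = T (map_poly (map_poly d) x)"
begin

abbreviation "dP \<equiv> map_poly (map_poly d)"

lemma additive_dP: "additive dP" by (intro additive_map_poly d)

lemma additive_const2: "additive (\<lambda>v::'p. [:[:v:]:])" by (simp add: additive_def)

lemma param: "additive (param_at S)" by (rule additive_poly_at[OF S additive_const2])

lemma param_shift: "param_at S (pCons 0 x) = S (param_at S x)"
  by (rule poly_at_shift[OF S additive_const2])

lemma param_d: "param_at S (map_poly d x) = dP (param_at S x)"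
proof -
  have "param_at S (map_poly d x) = poly_at S (\<lambda>c. [:[:d c:]:]) x"
    by (rule poly_at_map_poly[OF S additive_const2 d])
  also have "(\<lambda>c. [:[:d c:]:]) = (\<lambda>c. dP [:[:c:]:])"
    by (simp add: map_poly_pCons_additive d additive_map_poly)
  also have "poly_at S \<dots> x = dP (param_at S x)"
    by (rule poly_at_commute[OF S additive_const2 additive_dP dS])
  finally show ?thesis .
qed

lemma poly_at_minus_S:
  assumes "additive f"
  shows "poly_at T (\<lambda>u. - S (f u)) y = - S (poly_at T f y)"
  using poly_at_commute[OF T assms, of "\<lambda>u. - S u"] S
  by (simp add: additive_def ST additive.minus[OF T])

lemma poly_at_dP_S:
  assumes f: "additive f"
  shows "poly_at T (\<lambda>u. dP (f u) + S (f u)) y = dP (poly_at T f y) + S (poly_at T f y)"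
  using poly_at_commute[OF T f, of "\<lambda>u. dP u + S u"] additive_sum_fun[OF additive_dP S]
  by (simp add: ST dT additive.add[OF T])

lemma trisesquilinear_lp_right:
  assumes p: "sesquilinear_product d p" and q: "sesquilinear_product d q"
  shows "trisesquilinear d S T (\<lambda>a b c. lp_right p S a T (q b c))"
proof -
  interpret p: sesquilinear_product d p by fact
  interpret q: sesquilinear_product d q by fact
  let ?f = "\<lambda>a u. param_at S (p a u)"
  have f1: "additive (\<lambda>a. ?f a u)" for u
    by (rule additive_compose_fun[OF param p.left_additive])
  have f2: "additive (?f a)" for a
    by (rule additive_compose_fun[OF param p.right_additive])
  have R: "additive (poly_at T (?f a))" for a by (rule additive_poly_at[OF T f2])
  have Rshift: "poly_at T (?f a) (pCons 0 y) = T (poly_at T (?f a) y)" for a y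
    by (rule poly_at_shift[OF T f2])
  have Rd: "poly_at T (?f a) (map_poly d y) = dP (poly_at T (?f a) y) + S (poly_at T (?f a) y)"
    for a y
    using poly_at_dP_S[OF f2]
    by (simp add: poly_at_map_poly[OF T f2 d] p.right_shift additive.add[OF param] param_shift param_d)
  have "poly_at T (?f (d a)) y = - S (poly_at T (?f a) y)" for a y
    using poly_at_minus_S[OF f2]
    by (simp only: p.left_shift additive.minus[OF param] param_shift)
  moreover have "poly_at T (?f (a + a')) y = poly_at T (?f a) y + poly_at T (?f a') y" for a a' y
    by (simp add: additive.add[OF f1] poly_at_sum_fun[OF T f2 f2])
  moreover have "additive (\<lambda>b. poly_at T (?f a) (q b c))" for a c
    by (rule additive_compose_fun[OF R q.left_additive])
  moreover have "additive (\<lambda>c. poly_at T (?f a) (q b c))" for a b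
    by (rule additive_compose_fun[OF R q.right_additive])
  ultimately show ?thesis
    unfolding trisesquilinear_def lp_right_def
    by (simp add: additive_def q.left_shift q.right_shift additive.minus[OF R] additive.add[OF R]
        Rshift Rd del: minus_pCons)
qed

end

text \<open>
  A \<open>\<partial>\<close> on \<open>b\<close> becomes \<open>\<partial> + S\<close> in the inner product; \<open>\<partial>\<close> in the left factor of the outer
  product acts as \<open>- (S + T)\<close>, which leaves \<open>- T\<close>.
\<close>

lemma trisesquilinear_lp_left:
  assumes ST: "parameter_pair d T S"
    and p: "sesquilinear_product d p" and q: "sesquilinear_product d q"
  shows "trisesquilinear d S T (\<lambda>a b c. lp_left p S (q a b) (\<lambda>x. S x + T x) c)"
proof -
  interpret ST: parameter_pair d T S by fact
  let ?U = "\<lambda>x. S x + T x"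
  interpret US: parameter_pair d ?U S
    using ST.S ST.T ST.ST ST.dS ST.dT ST.d
    by unfold_locales (simp_all add: additive_def additive.add[OF ST.additive_dP] algebra_simps)
  interpret p: sesquilinear_product d p by fact
  interpret q: sesquilinear_product d q by fact
  let ?f = "\<lambda>c u. param_at ?U (p u c)"
  have f1: "additive (\<lambda>c. ?f c u)" for u
    by (rule additive_compose_fun[OF US.param p.right_additive])
  have f2: "additive (?f c)" for c
    by (rule additive_compose_fun[OF US.param p.left_additive])
  have R: "additive (poly_at S (?f a))" for a by (rule additive_poly_at[OF US.T f2])
  have Rshift: "poly_at S (?f a) (pCons 0 y) = S (poly_at S (?f a) y)" for a y
    by (rule poly_at_shift[OF US.T f2])
  have Rd: "poly_at S (?f a) (map_poly d y) = - ?U (poly_at S (?f a) y)" for a y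
    using US.poly_at_minus_S[OF f2]
    by (simp only: poly_at_map_poly[OF US.T f2 US.d] p.left_shift additive.minus[OF US.param]
        US.param_shift)
  have "poly_at S (?f (d a)) y = ST.dP (poly_at S (?f a) y) + ?U (poly_at S (?f a) y)" for a y
    using US.poly_at_dP_S[OF f2]
    by (simp only: p.right_shift additive.add[OF US.param] US.param_shift US.param_d)
  moreover have "poly_at S (?f (a + a')) y = poly_at S (?f a) y + poly_at S (?f a') y" for a a' y
    by (simp add: additive.add[OF f1] poly_at_sum_fun[OF US.T f2 f2])
  moreover have "additive (\<lambda>b. poly_at S (?f c) (q b a))" for a c
    by (rule additive_compose_fun[OF R q.left_additive])
  moreover have "additive (\<lambda>b. poly_at S (?f c) (q a b))" for a c
    by (rule additive_compose_fun[OF R q.right_additive])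
  ultimately show ?thesis
    unfolding trisesquilinear_def lp_left_def
    by (simp add: additive_def q.left_shift q.right_shift additive.minus[OF R] additive.add[OF R]
        Rshift Rd del: minus_pCons)
qed

lemma trisesquilinear_eq_iff:
  fixes F G :: "'a::ab_group_add poly \<Rightarrow> 'a poly \<Rightarrow> 'a poly \<Rightarrow> 'a poly poly poly"
  assumes "trisesquilinear (pCons 0) S T F" "trisesquilinear (pCons 0) S T G"
  shows "(\<forall>x y z. F x y z = G x y z) \<longleftrightarrow>
    (\<forall>a b c. F [:a:] [:b:] [:c:] = G [:a:] [:b:] [:c:])"
  using trisesquilinear_eqI[OF assms] by blast

lemma additive_mult_lam: "additive (mult_lam :: 'p::ab_group_add poly poly \<Rightarrow> _)"
  unfolding mult_lam_def by (rule additive_pCons_0)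

lemma additive_mult_mu: "additive (mult_mu :: 'p::ab_group_add poly poly \<Rightarrow> _)"
  unfolding mult_mu_def by (rule additive_map_poly[OF additive_pCons_0])

lemma parameter_pair_lam_mu:
  assumes d: "additive d"
  shows "parameter_pair d mult_lam mult_mu"
  by unfold_locales
    (simp_all add: additive.add[OF d] additive.add[OF additive_mult_lam]
      additive.add[OF additive_mult_mu], simp_all add: mult_lam_def mult_mu_def poly_eq_iff
      coeff_map_poly coeff_pCons additive.zero[OF d] split: nat.split)

lemma parameter_pair_mu_lam:
  assumes d: "additive d"
  shows "parameter_pair d mult_mu mult_lam"
  using parameter_pair_lam_mu[OF d] unfolding parameter_pair_def by simp


section \<open>The sesquilinear extension is a \<open>\<lambda>\<close>-product\<close>

lemma vector_space_map_poly:
  assumes "vector_space s"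
  shows "vector_space (\<lambda>c. map_poly (s c))"
proof -
  interpret vector_space s by fact
  show ?thesis
    by unfold_locales
      (simp_all add: poly_eq_iff coeff_map_poly scale_right_distrib scale_left_distrib)
qed

text \<open>
  Sesquilinearity is built into the formula of the extension. Bilinearity over \<open>k\<close> holds because
  the scalars commute with the operators \<open>\<partial> + \<lambda>\<close> and \<open>- \<lambda>\<close> (\<open>S\<close> and \<open>T\<close> below) that the
  extension iterates.
\<close>

lemma lambda_product_sesquilinear_ext:
  fixes scale :: "'k::field_char_0 \<Rightarrow> 'a::ab_group_add \<Rightarrow> 'a"
  assumes V: "vector_space scale"
    and f: "bilinear_map scale (\<lambda>c. map_poly (map_poly (scale c))) f"
  shows "lambda_product (free_act scale) (sesquilinear_ext f)"
proof -
  let ?s = "\<lambda>c. map_poly (scale c)"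
  let ?t = "\<lambda>c. map_poly (map_poly (scale c))"
  define S where "S = (\<lambda>z::'a poly poly. map_poly (pCons 0) z + pCons 0 z)"
  define T where "T = (\<lambda>z::'a poly poly. - pCons 0 z)"
  have S: "additive S"
    unfolding S_def by (intro additive_sum_fun additive_map_poly additive_pCons_0)
  have T: "additive T"
    unfolding T_def by (simp add: additive_def)
  interpret vector_space scale by fact
  have s: "additive (scale c)" for c by (simp add: additive_def scale_right_distrib)
  have t: "additive (?t c)" for c by (intro additive_map_poly s)
  have tS: "?t c (S z) = S (?t c z)" and tT: "?t c (T z) = T (?t c z)" for c z
    by (simp_all add: S_def T_def poly_eq_iff coeff_map_poly coeff_pCons scale_right_distrib
        split: nat.split)
  note f1 = bilinear_map_additive_left[OF f] and f2 = bilinear_map_additive_right[OF f]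
  have fs1: "f (scale c a) b = ?t c (f a b)" and fs2: "f a (scale c b) = ?t c (f a b)" for a b c
    using f unfolding bilinear_map_def Vector_Spaces.linear_iff by auto
  define G where "G = (\<lambda>a y. poly_at S (f a) y)"
  have ext_eq: "sesquilinear_ext f x y = poly_at T (\<lambda>a. G a y) x" for x y
    by (simp add: sesquilinear_ext_def G_def S_def T_def)
  have commute: "poly_at S (\<lambda>b. ?t c (f a b)) y = ?t c (poly_at S (f a) y)" for c a y
    by (rule poly_at_commute[where g = "?t c", OF S f2 t tS])
  have G1: "additive (\<lambda>a. G a y)" for y
  proof -
    have "f (a + a') = (\<lambda>b. f a b + f a' b)" for a a'
      by (rule ext) (rule additive.add[OF f1])
    thus ?thesis
      unfolding G_def by (simp add: additive_def poly_at_sum_fun[OF S f2 f2])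
  qed
  have G2: "additive (G a)" for a
    unfolding G_def by (rule additive_poly_at[OF S f2])
  have Gs1: "G (scale c a) y = ?t c (G a y)" for c a y
  proof -
    have "f (scale c a) = (\<lambda>b. ?t c (f a b))" by (rule ext) (rule fs1)
    thus ?thesis
      unfolding G_def by (simp only: commute)
  qed
  have Gs2: "G a (?s c y) = ?t c (G a y)" for c a y
    unfolding G_def by (simp only: poly_at_map_poly[OF S f2 s] fs2 commute)
  have ext_commute: "poly_at T (\<lambda>a. ?t c (G a y)) x = ?t c (poly_at T (\<lambda>a. G a y) x)" for c x y
    by (rule poly_at_commute[where g = "?t c", OF T G1 t tT])
  have e1: "additive (\<lambda>x. sesquilinear_ext f x y)" for y
    unfolding ext_eq by (rule additive_poly_at[OF T G1])
  have e2: "additive (sesquilinear_ext f x)" for x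
    using poly_at_sum_fun[OF T G1 G1] by (simp add: additive_def ext_eq additive.add[OF G2])
  have es1: "sesquilinear_ext f (?s c x) y = ?t c (sesquilinear_ext f x y)" for c x y
    unfolding ext_eq by (simp only: poly_at_map_poly[OF T G1 s] Gs1 ext_commute)
  have es2: "sesquilinear_ext f x (?s c y) = ?t c (sesquilinear_ext f x y)" for c x y
    unfolding ext_eq by (simp only: Gs2 ext_commute)
  have act: "free_act scale [:c:] = ?s c" for c
    by (rule ext) (rule free_act_const)
  have partial: "free_act scale [:0, 1:] = pCons 0"
    by (rule ext) (rule free_act_partial[OF V])
  show ?thesis
  proof (intro lambda_product.intro lambda_product_axioms.intro module_free_act V)
    show "bilinear_map (\<lambda>c. free_act scale [:c:]) (\<lambda>c. map_poly (free_act scale [:c:]))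
        (sesquilinear_ext f)"
      unfolding bilinear_map_def Vector_Spaces.linear_iff act
      using vector_space_map_poly[OF V] vector_space_map_poly[OF vector_space_map_poly[OF V]]
        e1 e2 es1 es2
      by (simp add: additive_def)
    show "sesquilinear_ext f (free_act scale [:0, 1:] a) b = - pCons 0 (sesquilinear_ext f a b)"
      for a b
      unfolding partial by (rule sesquilinear_ext_left) (rule additive.zero[OF f1])
    show "sesquilinear_ext f a (free_act scale [:0, 1:] b) =
        map_poly (free_act scale [:0, 1:]) (sesquilinear_ext f a b) + pCons 0 (sesquilinear_ext f a b)"
      for a b
      unfolding partial by (rule sesquilinear_ext_right) (rule additive.zero[OF f2])
  qed
qed

section \<open>Coordinates in \<open>A[\<partial>][\<mu>][\<lambda>]\<close>\<close>

text \<open>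
  The operator \<open>\<partial> + S + T\<close>, by which \<open>\<partial>\<close> in the third argument of an iterated product acts.
\<close>

definition total_param ::
  "('a::ab_group_add poly poly poly \<Rightarrow> 'a poly poly poly) \<Rightarrow> ('a poly poly poly \<Rightarrow> 'a poly poly poly) \<Rightarrow>
   'a poly poly poly \<Rightarrow> 'a poly poly poly"
  where "total_param S T x = map_poly (map_poly (pCons 0)) x + S x + T x"

abbreviation coef :: "'a::ab_group_add \<Rightarrow> 'a poly poly poly"
  where "coef v \<equiv> [:[:[:v:]:]:]"

text \<open>
  A polynomial of degree at most two in the variables \<open>D = \<partial> + S + T\<close>, \<open>S\<close> and \<open>T\<close>, listed by its
  ten coefficients; \<open>ds\<close>, for example, is that of \<open>D S\<close>.
\<close>

definition quad_form ::
  "('a::ab_group_add poly poly poly \<Rightarrow> 'a poly poly poly) \<Rightarrow> ('a poly poly poly \<Rightarrow> 'a poly poly poly) \<Rightarrow>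
   'a \<Rightarrow> 'a \<Rightarrow> 'a \<Rightarrow> 'a \<Rightarrow> 'a \<Rightarrow> 'a \<Rightarrow> 'a \<Rightarrow> 'a \<Rightarrow> 'a \<Rightarrow> 'a \<Rightarrow> 'a poly poly poly"
  where "quad_form S T dd ds dt ss st tt d s t z =
    (let D = total_param S T in
      D (D (coef dd)) + D (S (coef ds)) + D (T (coef dt)) +
      S (S (coef ss)) + S (T (coef st)) + T (T (coef tt)) +
      D (coef d) + S (coef s) + T (coef t) + coef z)"

lemma additive_coef: "additive coef" by (simp add: additive_def)

lemma total_param_swap: "total_param T S = total_param S T"
  by (simp add: fun_eq_iff total_param_def algebra_simps)

lemma quad_form_lam_mu:
  "quad_form mult_lam mult_mu dd ds dt ss st tt d s t z =
    [:[:[:z, d, dd:], [:d + t, dd + dd + dt:], [:dd + dt + tt:]:],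
      [:[:d + s, dd + dd + ds:], [:dd + dd + ds + dt + st:]:],
      [:[:dd + ds + ss:]:]:]"
  by (simp only: quad_form_def Let_def total_param_def mult_lam_def mult_mu_def)
    (simp add: map_poly_pCons_additive additive_pCons_0 additive_map_poly ac_simps)

text \<open>
  The change of variables from \<open>(\<partial>, \<lambda>, \<mu>)\<close> to \<open>(D, \<lambda>, \<mu>)\<close> is unitriangular: the coefficients of
  \<open>1\<close>, \<open>\<partial>\<close>, \<open>\<partial>\<^sup>2\<close> are \<open>z\<close>, \<open>d\<close>, \<open>dd\<close>, and each remaining one adds one new unknown.
\<close>

lemma quad_form_lam_mu_eq_iff:
  "quad_form mult_lam mult_mu dd ds dt ss st tt d s t z =
   quad_form mult_lam mult_mu dd' ds' dt' ss' st' tt' d' s' t' z' \<longleftrightarrow>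
   dd = dd' \<and> ds = ds' \<and> dt = dt' \<and> ss = ss' \<and> st = st' \<and> tt = tt' \<and>
   d = d' \<and> s = s' \<and> t = t' \<and> z = z'"
  unfolding quad_form_lam_mu pCons_eq_iff by auto

lemma quad_form_lam_mu_swap:
  "quad_form mult_mu mult_lam dd ds dt ss st tt d s t z =
   quad_form mult_lam mult_mu dd dt ds tt st ss d t s z"
proof -
  interpret parameter_pair "pCons 0 :: 'a poly \<Rightarrow> _" mult_lam mult_mu
    by (rule parameter_pair_lam_mu[OF additive_pCons_0])
  show ?thesis
    by (simp only: quad_form_def Let_def total_param_swap[where S = mult_lam and T = mult_mu] ST ac_simps)
qed

locale polynomial_parameter_pair = parameter_pair "pCons 0" S T
  for S T :: "'a::ab_group_add poly poly poly \<Rightarrow> 'a poly poly poly"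
begin

lemma additive_total_param: "additive (total_param S T)"
  using additive.add[OF S] additive.add[OF T] additive.add[OF additive_dP]
  by (simp add: additive_def total_param_def)

lemma quad_form_add:
  "quad_form S T dd ds dt ss st tt d s t z + quad_form S T dd' ds' dt' ss' st' tt' d' s' t' z' =
   quad_form S T (dd + dd') (ds + ds') (dt + dt') (ss + ss') (st + st') (tt + tt')
     (d + d') (s + s') (t + t') (z + z')"
  by (simp only: quad_form_def Let_def additive.add[OF additive_coef] additive.add[OF S] additive.add[OF T]
     additive.add[OF additive_total_param] ac_simps)

lemma quad_form_diff:
  "quad_form S T dd ds dt ss st tt d s t z - quad_form S T dd' ds' dt' ss' st' tt' d' s' t' z' =
   quad_form S T (dd - dd') (ds - ds') (dt - dt') (ss - ss') (st - st') (tt - tt')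
     (d - d') (s - s') (t - t') (z - z')"
  using quad_form_add[of "dd - dd'" "ds - ds'" "dt - dt'" "ss - ss'" "st - st'" "tt - tt'"
     "d - d'" "s - s'" "t - t'" "z - z'" dd' ds' dt' ss' st' tt' d' s' t' z']
  by (simp add: diff_eq_eq)

end

section \<open>Quadratic products on a free module\<close>

text \<open>
  The element \<open>x + \<partial> u + \<lambda> w\<close> of \<open>A[\<partial>][\<lambda>]\<close>. A constant of its own keeps the shape when some
  of the coefficients vanish, where the list notation would collapse.
\<close>

definition affine_poly :: "'a::ab_group_add \<Rightarrow> 'a \<Rightarrow> 'a \<Rightarrow> 'a poly poly"
  where "affine_poly x u w = [:[:x, u:], [:w:]:]"

lemma affine_poly_add:
  "affine_poly x u w + affine_poly x' u' w' = affine_poly (x + x') (u + u') (w + w')"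
  by (simp add: affine_poly_def)

lemma affine_poly_diff:
  "affine_poly x u w - affine_poly x' u' w' = affine_poly (x - x') (u - u') (w - w')"
  by (simp add: affine_poly_def)

text \<open>
  At \<open>\<nu> = - \<lambda> - \<partial>\<close>, \<open>x + \<partial> u + \<nu> w\<close> is \<open>x + \<partial> (u - w) - \<lambda> w\<close>.
\<close>

lemma lp_opp_affine:
  assumes "vector_space scale" and "lp b a = affine_poly x u w"
  shows "lp_opp (free_act scale) lp b a = affine_poly x (u - w) (- w)"
proof -
  have p: "free_act scale [:0, 1:] = pCons 0"
    by (rule ext) (rule free_act_partial[OF assms(1)])
  have R: "additive (\<lambda>x. - pCons 0 x - map_poly (pCons 0) x)"
    by (simp add: additive_def additive.add[OF additive_map_poly[OF additive_pCons_0]])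
  show ?thesis
    unfolding lp_opp_def assms(2) p affine_poly_def poly_at_pCons[OF R additive_const_poly]
      poly_at_zero[OF additive_const_poly]
    by (simp add: map_poly_pCons)
qed

lemma bilinear_map_affine_poly:
  assumes V: "vector_space scale"
    and "bilinear_map scale scale f" "bilinear_map scale scale g" "bilinear_map scale scale h"
  shows "bilinear_map scale (\<lambda>c. map_poly (map_poly (scale c)))
    (\<lambda>a b. affine_poly (f a b) (g a b) (h a b))"
proof -
  interpret vector_space scale by fact
  show ?thesis
    using assms vector_space_map_poly[OF vector_space_map_poly[OF V]]
    unfolding bilinear_map_def Vector_Spaces.linear_iff affine_poly_def
    by (simp add: map_poly_pCons)
qed

lemma bilinear_map_swap: "bilinear_map s t f \<Longrightarrow> bilinear_map s t (\<lambda>a b. f b a)"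
  by (simp add: bilinear_map_def)

lemma bilinear_map_sum:
  assumes "bilinear_map s t f" "bilinear_map s t g"
  shows "bilinear_map s t (\<lambda>a b. f a b + g a b)"
proof -
  interpret vector_space t
    using assms(1) unfolding bilinear_map_def Vector_Spaces.linear_iff by blast
  show ?thesis
    using assms unfolding bilinear_map_def Vector_Spaces.linear_iff
    by (simp add: scale_right_distrib algebra_simps)
qed

lemma bilinear_map_zero:
  assumes "vector_space s"
  shows "bilinear_map s s (\<lambda>a b. 0)"
proof -
  interpret vector_space s by fact
  show ?thesis using assms by (simp add: bilinear_map_def Vector_Spaces.linear_iff)
qed

locale quadratic_product = vector_space scale
  for scale :: "'k::field_char_0 \<Rightarrow> 'a::ab_group_add \<Rightarrow> 'a" +
  fixes lhd :: "'a \<Rightarrow> 'a \<Rightarrow> 'a" (infixl "\<lhd>" 70)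
    and rhd :: "'a \<Rightarrow> 'a \<Rightarrow> 'a" (infixl "\<rhd>" 70)
    and diamond :: "'a \<Rightarrow> 'a \<Rightarrow> 'a" (infixl "\<diamond>" 70)
  assumes lhd: "bilinear_map scale scale (\<lhd>)"
    and rhd: "bilinear_map scale scale (\<rhd>)"
    and diamond: "bilinear_map scale scale (\<diamond>)"
begin

definition circ :: "'a poly \<Rightarrow> 'a poly \<Rightarrow> 'a poly poly"
  where "circ = sesquilinear_ext (\<lambda>a b. affine_poly (a \<diamond> b) (b \<lhd> a) (a \<rhd> b + b \<lhd> a))"

lemma circ_const: "circ [:a:] [:b:] = affine_poly (a \<diamond> b) (b \<lhd> a) (a \<rhd> b + b \<lhd> a)"
  by (simp add: circ_def sesquilinear_ext_const)

lemma vector_space_scale: "vector_space scale" by unfold_locales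

lemma lambda_product_circ: "lambda_product (free_act scale) circ"
  unfolding circ_def
  by (intro lambda_product_sesquilinear_ext bilinear_map_affine_poly bilinear_map_sum
      bilinear_map_swap[of _ _ "(\<lhd>)"] lhd rhd diamond vector_space_scale)

lemma partial_eq: "free_act scale [:0, 1:] = pCons 0"
  by (rule ext) (rule free_act_partial[OF vector_space_scale])

lemma opp_circ_const:
  "lp_opp (free_act scale) circ [:b:] [:a:] = affine_poly (b \<diamond> a) (- (b \<rhd> a)) (- (b \<rhd> a + a \<lhd> b))"
  by (subst lp_opp_affine[where lp = circ, OF vector_space_scale circ_const]) simp

sublocale sesquilinear_product "pCons 0" circ
  using lambda_product.sesquilinear[OF lambda_product_circ] by (simp only: partial_eq)

lemmas product_additive =
  bilinear_map_additive_left[OF lhd] bilinear_map_additive_right[OF lhd]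
  bilinear_map_additive_left[OF rhd] bilinear_map_additive_right[OF rhd]
  bilinear_map_additive_left[OF diamond] bilinear_map_additive_right[OF diamond]

lemmas product_simps =
  product_additive[THEN additive.add] product_additive[THEN additive.diff]
  product_additive[THEN additive.minus] product_additive[THEN additive.zero]

lemma circ_linear_right: "circ a [:x, u:] = circ a [:x:] + map_poly (pCons 0) (circ a [:u:]) + pCons 0 (circ a [:u:])"
proof -
  have "[:x, u:] = [:x:] + pCons 0 [:u:]" by simp
  thus ?thesis by (simp only: additive.add[OF right_additive] right_shift add.assoc)
qed

lemma circ_linear_left: "circ [:x, u:] c = circ [:x:] c - pCons 0 (circ [:u:] c)"
proof -
  have "[:x, u:] = [:x:] + pCons 0 [:u:]" by simp
  thus ?thesis by (simp only: additive.add[OF left_additive] left_shift) simp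
qed

end

context polynomial_parameter_pair
begin

abbreviation D where "D \<equiv> total_param S T"

lemma param_affine: "param_at S (affine_poly x u w) = coef x + dP (coef u) + S (coef w)"
  by (simp add: affine_poly_def poly_at_pCons[OF S additive_const2] poly_at_zero[OF additive_const2] map_poly_pCons
     additive.zero[OF S])

text \<open>
  The evaluations below are done with \<open>\<partial>\<close> replaced by \<open>D - S - T\<close>. A generator product
  \<open>a \<circ>\<^sub>S b\<close> is then \<open>(D - T) (b \<lhd> a) + S (a \<rhd> b) + a \<diamond> b\<close>.
\<close>

lemma dP_eq: "dP x = D x - S x - T x"
  by (simp add: total_param_def)

lemma D_S: "D (S x) = S (D x)" and D_T: "D (T x) = T (D x)"
  by (simp_all add: total_param_def additive.add[OF S] additive.add[OF T] ST dS dT)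

lemmas operator_add =
  additive.add[OF S] additive.add[OF T] additive.add[OF additive_total_param]
  additive.add[OF additive_coef]

lemmas operator_diff =
  additive.diff[OF S] additive.diff[OF T] additive.diff[OF additive_total_param]
  additive.diff[OF additive_coef]

lemmas operator_minus =
  additive.minus[OF S] additive.minus[OF T] additive.minus[OF additive_total_param]
  additive.minus[OF additive_coef]

lemmas operator_zero =
  additive.zero[OF S] additive.zero[OF T] additive.zero[OF additive_total_param]
  additive.zero[OF additive_coef]

text \<open>
  \<open>a \<circ>\<^sub>S y\<close> for \<open>y = x + \<partial> u + T w\<close>: here \<open>\<partial>\<close> in the right factor acts as \<open>\<partial> + S = D - T\<close>, so
  the value is \<open>a \<circ>\<^sub>S x + (D - T) (a \<circ>\<^sub>S u) + T (a \<circ>\<^sub>S w)\<close>.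
\<close>

lemma lp_right_affine:
  assumes "quadratic_product scale lhd rhd ls"
  shows "lp_right (quadratic_product.circ lhd rhd ls) S [:a:] T (affine_poly x u w) =
    quad_form S T (lhd u a) (rhd a u) (lhd w a - lhd u a - lhd u a) 0 (rhd a w - rhd a u)
      (lhd u a - lhd w a) (lhd x a + ls a u) (rhd a x) (ls a w - ls a u - lhd x a) (ls a x)"
proof -
  interpret quadratic_product scale lhd rhd ls by fact
  have circ_at: "param_at S (circ [:a:] [:v:]) = D (coef (lhd v a)) - T (coef (lhd v a)) + S (coef (rhd a v)) + coef (ls a v)" for v
    by (simp only: circ_const param_affine dP_eq operator_add) (simp only: algebra_simps)
  have f: "additive (\<lambda>v. param_at S (circ [:a:] v))"
    by (rule additive_compose_fun[OF param right_additive])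
  have "lp_right circ S [:a:] T (affine_poly x u w) =
    param_at S (circ [:a:] [:x, u:]) + T (param_at S (circ [:a:] [:w:]))"
    unfolding lp_right_def affine_poly_def
    by (simp add: poly_at_pCons[OF T f] poly_at_zero[OF f] operator_zero)
  also have "param_at S (circ [:a:] [:x, u:]) =
    param_at S (circ [:a:] [:x:]) + D (param_at S (circ [:a:] [:u:])) - T (param_at S (circ [:a:] [:u:]))"
    by (simp only: circ_linear_right additive.add[OF param] param_d param_shift dP_eq) (simp only: algebra_simps)
  finally show ?thesis
    unfolding circ_at quad_form_def Let_def
    by (simp only: operator_add operator_diff operator_zero D_S D_T ST) (simp add: algebra_simps)
qed

text \<open>
  \<open>y \<circ>\<^sub>S\<^sub>+\<^sub>T c\<close> for \<open>y = x + \<partial> u + S w\<close>: here \<open>\<partial>\<close> in the left factor acts as \<open>- (S + T)\<close>, so the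
  value is \<open>x \<circ> c - (S + T) (u \<circ> c) + S (w \<circ> c)\<close>, all products with parameter \<open>S + T\<close>.
\<close>

lemma lp_left_affine:
  assumes "quadratic_product scale lhd rhd ls"
  shows "lp_left (quadratic_product.circ lhd rhd ls) S (affine_poly x u w) (\<lambda>z. S z + T z) [:c:] =
    quad_form S T 0 (lhd c w - lhd c u) (- lhd c u) (rhd w c - rhd u c) (rhd w c - rhd u c - rhd u c)
      (- rhd u c) (lhd c x) (rhd x c - ls u c + ls w c) (rhd x c - ls u c) (ls x c)"
proof -
  let ?U = "\<lambda>z. S z + T z"
  interpret quadratic_product scale lhd rhd ls by fact
  interpret U: polynomial_parameter_pair ?U S
    unfolding polynomial_parameter_pair_def
    using S T ST dS dT d
    by unfold_locales (simp_all add: additive_def additive.add[OF additive_dP] algebra_simps)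
  have circ_at: "param_at ?U (circ [:v:] [:c:]) = D (coef (lhd c v)) + ?U (coef (rhd v c)) + coef (ls v c)" for v
    by (simp only: circ_const U.param_affine dP_eq operator_add) (simp only: algebra_simps)
  have f: "additive (\<lambda>v. param_at ?U (circ v [:c:]))"
    by (rule additive_compose_fun[OF U.param left_additive])
  have "lp_left circ S (affine_poly x u w) ?U [:c:] =
    param_at ?U (circ [:x, u:] [:c:]) + S (param_at ?U (circ [:w:] [:c:]))"
    unfolding lp_left_def affine_poly_def
    by (simp add: poly_at_pCons[OF S f] poly_at_zero[OF f] operator_zero)
  also have "param_at ?U (circ [:x, u:] [:c:]) =
    param_at ?U (circ [:x:] [:c:]) - ?U (param_at ?U (circ [:u:] [:c:]))"
    by (simp only: circ_linear_left additive.diff[OF U.param] U.param_shift)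
  finally show ?thesis
    unfolding circ_at quad_form_def Let_def
    by (simp only: operator_add operator_diff operator_minus operator_zero D_S D_T ST) (simp add: algebra_simps)
qed

end

section \<open>Evaluation at \<open>\<lambda>\<close> and \<open>\<mu>\<close>\<close>

lemma mult_lam_mu_eq: "mult_lam_mu = (\<lambda>z. mult_lam z + mult_mu z)"
  "mult_lam_mu = (\<lambda>z. mult_mu z + mult_lam z)"
  by (simp_all add: fun_eq_iff mult_lam_mu_def add.commute)

lemma trisesquilinear_lam_mu:
  assumes p: "sesquilinear_product d p" and q: "sesquilinear_product d q"
  shows "trisesquilinear d mult_lam mult_mu (\<lambda>a b c. lp_right p mult_lam a mult_mu (q b c))"
    and "trisesquilinear d mult_lam mult_mu (\<lambda>a b c. lp_right p mult_mu b mult_lam (q a c))"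
    and "trisesquilinear d mult_lam mult_mu (\<lambda>a b c. lp_left p mult_lam (q a b) mult_lam_mu c)"
    and "trisesquilinear d mult_lam mult_mu (\<lambda>a b c. lp_left p mult_mu (q b a) mult_lam_mu c)"
proof -
  have d: "additive d" using p by (rule sesquilinear_product.d_additive)
  note lm = parameter_pair_lam_mu[OF d] and ml = parameter_pair_mu_lam[OF d]
  show "trisesquilinear d mult_lam mult_mu (\<lambda>a b c. lp_right p mult_lam a mult_mu (q b c))"
    by (rule parameter_pair.trisesquilinear_lp_right[OF lm p q])
  show "trisesquilinear d mult_lam mult_mu (\<lambda>a b c. lp_right p mult_mu b mult_lam (q a c))"
    by (rule trisesquilinear_swap[OF parameter_pair.trisesquilinear_lp_right[OF ml p q]])
  show "trisesquilinear d mult_lam mult_mu (\<lambda>a b c. lp_left p mult_lam (q a b) mult_lam_mu c)"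
    unfolding mult_lam_mu_eq(1) by (rule trisesquilinear_lp_left[OF ml p q])
  show "trisesquilinear d mult_lam mult_mu (\<lambda>a b c. lp_left p mult_mu (q b a) mult_lam_mu c)"
    unfolding mult_lam_mu_eq(2)
    by (rule trisesquilinear_swap[OF trisesquilinear_lp_left[OF lm p q]])
qed

lemma polynomial_parameter_pair_lam_mu: "polynomial_parameter_pair mult_lam mult_mu"
  and polynomial_parameter_pair_mu_lam: "polynomial_parameter_pair mult_mu mult_lam"
  unfolding polynomial_parameter_pair_def
  by (intro parameter_pair_lam_mu parameter_pair_mu_lam additive_pCons_0)+

lemmas lp_right_lam_mu_affine =
  polynomial_parameter_pair.lp_right_affine[OF polynomial_parameter_pair_lam_mu]
lemmas lp_right_mu_lam_affine =
  polynomial_parameter_pair.lp_right_affine[OF polynomial_parameter_pair_mu_lam,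
    unfolded quad_form_lam_mu_swap]
lemmas lp_left_lam_affine =
  polynomial_parameter_pair.lp_left_affine[OF polynomial_parameter_pair_lam_mu,
    folded mult_lam_mu_eq]
lemmas lp_left_mu_affine =
  polynomial_parameter_pair.lp_left_affine[OF polynomial_parameter_pair_mu_lam,
    folded mult_lam_mu_eq, unfolded quad_form_lam_mu_swap]
lemmas quad_form_lam_mu_add =
  polynomial_parameter_pair.quad_form_add[OF polynomial_parameter_pair_lam_mu]
lemmas quad_form_lam_mu_diff =
  polynomial_parameter_pair.quad_form_diff[OF polynomial_parameter_pair_lam_mu]

section \<open>Left-symmetric conformal algebras and pre-GD-algebras\<close>

context quadratic_product
begin

text \<open>
  The four terms of the left-symmetry identity on generators. The two terms with \<open>\<mu>\<close> come from
  those with \<open>\<lambda>\<close> by exchanging \<open>a\<close> with \<open>b\<close> and \<open>\<lambda>\<close> with \<open>\<mu>\<close>.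
\<close>

lemma lp_right_circ_lam:
  "lp_right circ mult_lam [:a:] mult_mu (circ [:b:] [:c:]) =
    quad_form mult_lam mult_mu
      ((c \<lhd> b) \<lhd> a) (a \<rhd> (c \<lhd> b)) ((b \<rhd> c) \<lhd> a - (c \<lhd> b) \<lhd> a)
      0 (a \<rhd> (b \<rhd> c)) (- ((b \<rhd> c) \<lhd> a))
      (a \<diamond> (c \<lhd> b) + (b \<diamond> c) \<lhd> a) (a \<rhd> (b \<diamond> c)) (a \<diamond> (b \<rhd> c) - (b \<diamond> c) \<lhd> a)
      (a \<diamond> (b \<diamond> c))"
  unfolding circ_const lp_right_lam_mu_affine[OF quadratic_product_axioms] quad_form_lam_mu_eq_iff
  by (simp add: product_simps algebra_simps)

lemma lp_right_circ_mu:
  "lp_right circ mult_mu [:b:] mult_lam (circ [:a:] [:c:]) =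
    quad_form mult_lam mult_mu
      ((c \<lhd> a) \<lhd> b) ((a \<rhd> c) \<lhd> b - (c \<lhd> a) \<lhd> b) (b \<rhd> (c \<lhd> a))
      (- ((a \<rhd> c) \<lhd> b)) (b \<rhd> (a \<rhd> c)) 0
      (b \<diamond> (c \<lhd> a) + (a \<diamond> c) \<lhd> b) (b \<diamond> (a \<rhd> c) - (a \<diamond> c) \<lhd> b) (b \<rhd> (a \<diamond> c))
      (b \<diamond> (a \<diamond> c))"
  unfolding circ_const lp_right_mu_lam_affine[OF quadratic_product_axioms] quad_form_lam_mu_eq_iff
  by (simp add: product_simps algebra_simps)

lemma lp_left_circ_lam:
  "lp_left circ mult_lam (circ [:a:] [:b:]) mult_lam_mu [:c:] =
    quad_form mult_lam mult_mu
      0 (c \<lhd> (a \<rhd> b)) (- (c \<lhd> (b \<lhd> a)))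
      ((a \<rhd> b) \<rhd> c) ((a \<rhd> b) \<rhd> c - (b \<lhd> a) \<rhd> c) (- ((b \<lhd> a) \<rhd> c))
      (c \<lhd> (a \<diamond> b)) ((a \<rhd> b) \<diamond> c + (a \<diamond> b) \<rhd> c) ((a \<diamond> b) \<rhd> c - (b \<lhd> a) \<diamond> c)
      ((a \<diamond> b) \<diamond> c)"
  unfolding circ_const lp_left_lam_affine[OF quadratic_product_axioms] quad_form_lam_mu_eq_iff
  by (simp add: product_simps algebra_simps)

lemma lp_left_circ_mu:
  "lp_left circ mult_mu (circ [:b:] [:a:]) mult_lam_mu [:c:] =
    quad_form mult_lam mult_mu
      0 (- (c \<lhd> (a \<lhd> b))) (c \<lhd> (b \<rhd> a))
      (- ((a \<lhd> b) \<rhd> c)) ((b \<rhd> a) \<rhd> c - (a \<lhd> b) \<rhd> c) ((b \<rhd> a) \<rhd> c)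
      (c \<lhd> (b \<diamond> a)) ((b \<diamond> a) \<rhd> c - (a \<lhd> b) \<diamond> c) ((b \<rhd> a) \<diamond> c + (b \<diamond> a) \<rhd> c)
      ((b \<diamond> a) \<diamond> c)"
  unfolding circ_const lp_left_mu_affine[OF quadratic_product_axioms] quad_form_lam_mu_eq_iff
  by (simp add: product_simps algebra_simps)

lemma left_symmetric_conformal_iff_const:
  "left_symmetric_conformal_algebra (free_act scale) circ \<longleftrightarrow>
    (\<forall>a b c. lp_right circ mult_lam [:a:] mult_mu (circ [:b:] [:c:]) -
        lp_left circ mult_lam (circ [:a:] [:b:]) mult_lam_mu [:c:] =
      lp_right circ mult_mu [:b:] mult_lam (circ [:a:] [:c:]) -
        lp_left circ mult_mu (circ [:b:] [:a:]) mult_lam_mu [:c:])"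
proof -
  note t = trisesquilinear_lam_mu[OF sesquilinear_product_axioms sesquilinear_product_axioms]
  note d = additive_pCons_0 additive_mult_lam additive_mult_mu
  show ?thesis
    unfolding left_symmetric_conformal_algebra_def left_symmetric_conformal_algebra_axioms_def
    using trisesquilinear_eq_iff[OF trisesquilinear_diff[OF t(1) t(3) d]
        trisesquilinear_diff[OF t(2) t(4) d]] lambda_product_circ
    by blast
qed

text \<open>
  The coefficient of \<open>D\<^sup>2\<close> is the fourth pre-Novikov axiom, \<open>D \<lambda>\<close> the second, \<open>\<lambda>\<^sup>2\<close> the third,
  \<open>\<lambda> \<mu>\<close> the first; \<open>D\<close> and \<open>\<lambda>\<close> are the two pre-GD axioms, and the constant coefficient is
  left-symmetry. The coefficients of \<open>D \<mu>\<close>, \<open>\<mu>\<^sup>2\<close> and \<open>\<mu>\<close> repeat those of \<open>D \<lambda>\<close>, \<open>\<lambda>\<^sup>2\<close>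
  and \<open>\<lambda>\<close> with \<open>a\<close> and \<open>b\<close> exchanged.
\<close>

theorem left_symmetric_conformal_iff_pre_gd:
  "left_symmetric_conformal_algebra (free_act scale) circ \<longleftrightarrow> pre_gd_algebra scale (\<lhd>) (\<rhd>) (\<diamond>)"
proof
  assume "left_symmetric_conformal_algebra (free_act scale) circ"
  note id = this[unfolded left_symmetric_conformal_iff_const lp_right_circ_lam lp_right_circ_mu
      lp_left_circ_lam lp_left_circ_mu quad_form_lam_mu_diff quad_form_lam_mu_eq_iff]
  have DD: "(c \<lhd> b) \<lhd> a - 0 = (c \<lhd> a) \<lhd> b - 0"
    and D_lam: "a \<rhd> (c \<lhd> b) - c \<lhd> (a \<rhd> b) =
      (a \<rhd> c) \<lhd> b - (c \<lhd> a) \<lhd> b - - (c \<lhd> (a \<lhd> b))"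
    and lam_lam: "0 - (a \<rhd> b) \<rhd> c = - ((a \<rhd> c) \<lhd> b) - - ((a \<lhd> b) \<rhd> c)"
    and lam_mu: "a \<rhd> (b \<rhd> c) - ((a \<rhd> b) \<rhd> c - (b \<lhd> a) \<rhd> c) =
      b \<rhd> (a \<rhd> c) - ((b \<rhd> a) \<rhd> c - (a \<lhd> b) \<rhd> c)"
    and D: "a \<diamond> (c \<lhd> b) + (b \<diamond> c) \<lhd> a - c \<lhd> (a \<diamond> b) =
      b \<diamond> (c \<lhd> a) + (a \<diamond> c) \<lhd> b - c \<lhd> (b \<diamond> a)"
    and lam: "a \<rhd> (b \<diamond> c) - ((a \<rhd> b) \<diamond> c + (a \<diamond> b) \<rhd> c) =
      b \<diamond> (a \<rhd> c) - (a \<diamond> c) \<lhd> b - ((b \<diamond> a) \<rhd> c - (a \<lhd> b) \<diamond> c)"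
    and const: "a \<diamond> (b \<diamond> c) - (a \<diamond> b) \<diamond> c = b \<diamond> (a \<diamond> c) - (b \<diamond> a) \<diamond> c" for a b c
    using id by blast+
  show "pre_gd_algebra scale (\<lhd>) (\<rhd>) (\<diamond>)"
  proof unfold_locales
    fix a b c
    show "a \<rhd> (b \<rhd> c) = (a \<rhd> b + a \<lhd> b) \<rhd> c + b \<rhd> (a \<rhd> c) - (b \<rhd> a + b \<lhd> a) \<rhd> c"
      using lam_mu[of a b c] by (simp add: product_simps algebra_simps)
    show "a \<rhd> (b \<lhd> c) = (a \<rhd> b) \<lhd> c + b \<lhd> (a \<lhd> c + a \<rhd> c) - (b \<lhd> a) \<lhd> c"
      using D_lam[where a = a and b = c and c = b] by (simp add: product_simps algebra_simps)
    show "(a \<lhd> b + a \<rhd> b) \<rhd> c = (a \<rhd> c) \<lhd> b"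
      using lam_lam[of a b c] by (simp add: product_simps algebra_simps)
    show "(a \<lhd> b) \<lhd> c = (a \<lhd> c) \<lhd> b"
      using DD[where a = c and b = b and c = a] by simp
    show "(a \<diamond> b) \<diamond> c - a \<diamond> (b \<diamond> c) = (b \<diamond> a) \<diamond> c - b \<diamond> (a \<diamond> c)"
      using const[of a b c] by (simp add: algebra_simps)
    show "c \<lhd> (a \<diamond> b - b \<diamond> a) - a \<diamond> (c \<lhd> b) - (b \<diamond> c) \<lhd> a =
        - (b \<diamond> (c \<lhd> a)) - (a \<diamond> c) \<lhd> b"
      using D[where a = a and b = b and c = c] by (simp add: product_simps algebra_simps)
    show "(a \<diamond> b - b \<diamond> a) \<rhd> c + (a \<lhd> b + a \<rhd> b) \<diamond> c =
        a \<rhd> (b \<diamond> c) - b \<diamond> (a \<rhd> c) + (a \<diamond> c) \<lhd> b"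
      using lam[of a b c] by (simp add: product_simps algebra_simps)
  qed (rule lhd rhd diamond)+
next
  assume "pre_gd_algebra scale (\<lhd>) (\<rhd>) (\<diamond>)"
  then interpret gd: pre_gd_algebra scale "(\<lhd>)" "(\<rhd>)" "(\<diamond>)" .
  show "left_symmetric_conformal_algebra (free_act scale) circ"
    unfolding left_symmetric_conformal_iff_const lp_right_circ_lam lp_right_circ_mu
      lp_left_circ_lam lp_left_circ_mu quad_form_lam_mu_diff quad_form_lam_mu_eq_iff
  proof (intro allI conjI)
    fix a b c
    show "(c \<lhd> b) \<lhd> a - 0 = (c \<lhd> a) \<lhd> b - 0"
      using gd.pre_novikov_4[of c b a] by simp
    show "a \<rhd> (c \<lhd> b) - c \<lhd> (a \<rhd> b) = (a \<rhd> c) \<lhd> b - (c \<lhd> a) \<lhd> b - - (c \<lhd> (a \<lhd> b))"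
      using gd.pre_novikov_2[of a c b] by (simp add: product_simps algebra_simps)
    show "(b \<rhd> c) \<lhd> a - (c \<lhd> b) \<lhd> a - - (c \<lhd> (b \<lhd> a)) = b \<rhd> (c \<lhd> a) - c \<lhd> (b \<rhd> a)"
      using gd.pre_novikov_2[of b c a] by (simp add: product_simps algebra_simps)
    show "0 - (a \<rhd> b) \<rhd> c = - ((a \<rhd> c) \<lhd> b) - - ((a \<lhd> b) \<rhd> c)"
      using gd.pre_novikov_3[of a b c] by (simp add: product_simps algebra_simps)
    show "a \<rhd> (b \<rhd> c) - ((a \<rhd> b) \<rhd> c - (b \<lhd> a) \<rhd> c) =
        b \<rhd> (a \<rhd> c) - ((b \<rhd> a) \<rhd> c - (a \<lhd> b) \<rhd> c)"
      using gd.pre_novikov_1[of a b c] by (simp add: product_simps algebra_simps)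
    show "- ((b \<rhd> c) \<lhd> a) - - ((b \<lhd> a) \<rhd> c) = 0 - (b \<rhd> a) \<rhd> c"
      using gd.pre_novikov_3[of b a c] by (simp add: product_simps algebra_simps)
    show "a \<diamond> (c \<lhd> b) + (b \<diamond> c) \<lhd> a - c \<lhd> (a \<diamond> b) =
        b \<diamond> (c \<lhd> a) + (a \<diamond> c) \<lhd> b - c \<lhd> (b \<diamond> a)"
      using gd.pre_gd_1[of c a b] by (simp add: product_simps algebra_simps)
    show "a \<rhd> (b \<diamond> c) - ((a \<rhd> b) \<diamond> c + (a \<diamond> b) \<rhd> c) =
        b \<diamond> (a \<rhd> c) - (a \<diamond> c) \<lhd> b - ((b \<diamond> a) \<rhd> c - (a \<lhd> b) \<diamond> c)"
      using gd.pre_gd_2[of a b c] by (simp add: product_simps algebra_simps)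
    show "a \<diamond> (b \<rhd> c) - (b \<diamond> c) \<lhd> a - ((a \<diamond> b) \<rhd> c - (b \<lhd> a) \<diamond> c) =
        b \<rhd> (a \<diamond> c) - ((b \<rhd> a) \<diamond> c + (b \<diamond> a) \<rhd> c)"
      using gd.pre_gd_2[of b a c] by (simp add: product_simps algebra_simps)
    show "a \<diamond> (b \<diamond> c) - (a \<diamond> b) \<diamond> c = b \<diamond> (a \<diamond> c) - (b \<diamond> a) \<diamond> c"
      using gd.left_symmetric[of a b c] by (simp add: algebra_simps)
  qed
qed

end

section \<open>Pre-Poisson conformal algebras and pre-PGD-algebras\<close>

locale four_products = quadratic_product scale lhd rhd diamond
  for scale :: "'k::field_char_0 \<Rightarrow> 'a::ab_group_add \<Rightarrow> 'a"
    and lhd :: "'a \<Rightarrow> 'a \<Rightarrow> 'a" (infixl "\<lhd>" 70)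
    and rhd :: "'a \<Rightarrow> 'a \<Rightarrow> 'a" (infixl "\<rhd>" 70)
    and diamond :: "'a \<Rightarrow> 'a \<Rightarrow> 'a" (infixl "\<diamond>" 70) +
  fixes succ :: "'a \<Rightarrow> 'a \<Rightarrow> 'a" (infixl "\<succ>" 70)
  assumes succ: "bilinear_map scale scale (\<succ>)"
begin

text \<open>
  With \<open>\<lhd> = \<rhd> = 0\<close> the quadratic product is the constant extension of its last operation, so
  everything proved about \<open>\<circ>\<^sub>\<lambda>\<close> applies to \<open>\<succ>\<^sub>\<lambda>\<close>.
\<close>

sublocale zinb: quadratic_product scale "\<lambda>_ _. 0" "\<lambda>_ _. 0" "(\<succ>)"
  by unfold_locales (intro bilinear_map_zero vector_space_scale succ)+

lemmas succ_additive = bilinear_map_additive_left[OF succ] bilinear_map_additive_right[OF succ]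

lemmas succ_simps =
  succ_additive[THEN additive.add] succ_additive[THEN additive.diff]
  succ_additive[THEN additive.minus] succ_additive[THEN additive.zero]

lemma sesquilinear_symm_zinb:
  "sesquilinear_product (pCons 0) (\<lambda>a b. zinb.circ a b + lp_opp (free_act scale) zinb.circ b a)"
  by (intro sesquilinear_product_add zinb.sesquilinear_product_axioms
      sesquilinear_product_opp[where act = "free_act scale", unfolded partial_eq])

lemma sesquilinear_commutator_circ:
  "sesquilinear_product (pCons 0) (\<lambda>a b. circ a b - lp_opp (free_act scale) circ b a)"
  by (intro sesquilinear_product_diff sesquilinear_product_axioms
      sesquilinear_product_opp[where act = "free_act scale", unfolded partial_eq])

lemma symm_zinb_const:
  "zinb.circ [:a:] [:b:] + lp_opp (free_act scale) zinb.circ [:b:] [:a:] =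
    affine_poly (a \<succ> b + b \<succ> a) 0 0"
  by (simp add: zinb.circ_const zinb.opp_circ_const affine_poly_add)

lemma commutator_circ_const:
  "circ [:a:] [:b:] - lp_opp (free_act scale) circ [:b:] [:a:] =
    affine_poly (a \<diamond> b - b \<diamond> a) (b \<lhd> a + b \<rhd> a) (a \<rhd> b + b \<lhd> a + b \<rhd> a + a \<lhd> b)"
  by (simp add: circ_const opp_circ_const affine_poly_diff algebra_simps)

theorem zinbiel_conformal_iff_zinbiel:
  "zinbiel_conformal_algebra (free_act scale) zinb.circ \<longleftrightarrow> zinbiel_algebra scale (\<succ>)"
proof -
  note t1 = trisesquilinear_lam_mu(1)[OF zinb.sesquilinear_product_axioms zinb.sesquilinear_product_axioms]
  note t2 = trisesquilinear_lam_mu(3)[OF zinb.sesquilinear_product_axioms sesquilinear_symm_zinb]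
  have "zinbiel_conformal_algebra (free_act scale) zinb.circ \<longleftrightarrow>
    (\<forall>a b c. a \<succ> (b \<succ> c) = (a \<succ> b + b \<succ> a) \<succ> c)"
    unfolding zinbiel_conformal_algebra_def zinbiel_conformal_algebra_axioms_def
      trisesquilinear_eq_iff[OF t1 t2] symm_zinb_const
    unfolding zinb.circ_const
      lp_right_lam_mu_affine[OF zinb.quadratic_product_axioms]
      lp_left_lam_affine[OF zinb.quadratic_product_axioms] quad_form_lam_mu_eq_iff
    using zinb.lambda_product_circ by (simp add: succ_simps)
  also have "\<dots> \<longleftrightarrow> zinbiel_algebra scale (\<succ>)"
    using succ vector_space_scale
    unfolding zinbiel_algebra_def zinbiel_algebra_axioms_def by (simp add: add.commute)
  finally show ?thesis .
qed

text \<open>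
  Only the coefficients of \<open>D\<close>, \<open>\<lambda>\<close>, \<open>\<mu>\<close> and \<open>1\<close> survive, in this order on the right-hand side:
  a product with \<open>\<succ>\<^sub>\<lambda>\<close> contributes no power of \<open>\<lambda>\<close> or \<open>\<partial>\<close> on generators.
\<close>

lemma pre_poisson_conformal_1_iff:
  "(\<forall>a b c. lp_left zinb.circ mult_lam (circ a b - lp_opp (free_act scale) circ b a) mult_lam_mu c =
     lp_right circ mult_lam a mult_mu (zinb.circ b c) - lp_right zinb.circ mult_mu b mult_lam (circ a c)) \<longleftrightarrow>
   (\<forall>a b c. b \<succ> (c \<lhd> a) = (b \<succ> c) \<lhd> a \<and>
      (a \<lhd> b + a \<rhd> b) \<succ> c = a \<rhd> (b \<succ> c) - b \<succ> (a \<rhd> c) \<and>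
      (b \<succ> c) \<lhd> a = (b \<lhd> a + b \<rhd> a) \<succ> c \<and>
      (a \<diamond> b - b \<diamond> a) \<succ> c = a \<diamond> (b \<succ> c) - b \<succ> (a \<diamond> c))"
proof -
  note t1 = trisesquilinear_lam_mu(3)[OF zinb.sesquilinear_product_axioms sesquilinear_commutator_circ]
  note t2 = trisesquilinear_lam_mu(1)[OF sesquilinear_product_axioms zinb.sesquilinear_product_axioms]
  note t3 = trisesquilinear_lam_mu(2)[OF zinb.sesquilinear_product_axioms sesquilinear_product_axioms]
  note d = additive_pCons_0 additive_mult_lam additive_mult_mu
  show ?thesis
    unfolding trisesquilinear_eq_iff[OF t1 trisesquilinear_diff[OF t2 t3 d]]
      commutator_circ_const
    unfolding circ_const zinb.circ_const
      lp_left_lam_affine[OF zinb.quadratic_product_axioms]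
      lp_right_lam_mu_affine[OF quadratic_product_axioms]
      lp_right_mu_lam_affine[OF zinb.quadratic_product_axioms]
      quad_form_lam_mu_diff quad_form_lam_mu_eq_iff
    by (simp add: product_simps succ_simps algebra_simps)
qed

lemma pre_poisson_conformal_2_iff:
  "(\<forall>a b c. lp_left circ mult_lam (zinb.circ a b + lp_opp (free_act scale) zinb.circ b a) mult_lam_mu c =
     lp_right zinb.circ mult_lam a mult_mu (circ b c) + lp_right zinb.circ mult_mu b mult_lam (circ a c)) \<longleftrightarrow>
   (\<forall>a b c. c \<lhd> (a \<succ> b + b \<succ> a) = a \<succ> (c \<lhd> b) + b \<succ> (c \<lhd> a) \<and>
      (a \<succ> b + b \<succ> a) \<rhd> c = b \<succ> (a \<rhd> c) \<and>
      (a \<succ> b + b \<succ> a) \<rhd> c = a \<succ> (b \<rhd> c) \<and>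
      (a \<succ> b + b \<succ> a) \<diamond> c = a \<succ> (b \<diamond> c) + b \<succ> (a \<diamond> c))"
proof -
  note t1 = trisesquilinear_lam_mu(3)[OF sesquilinear_product_axioms sesquilinear_symm_zinb]
  note t2 = trisesquilinear_lam_mu(1)[OF zinb.sesquilinear_product_axioms sesquilinear_product_axioms]
  note t3 = trisesquilinear_lam_mu(2)[OF zinb.sesquilinear_product_axioms sesquilinear_product_axioms]
  note d = additive_pCons_0 additive_mult_lam additive_mult_mu
  show ?thesis
    unfolding trisesquilinear_eq_iff[OF t1 trisesquilinear_add[OF t2 t3 d]]
      symm_zinb_const
    unfolding circ_const
      lp_left_lam_affine[OF quadratic_product_axioms]
      lp_right_lam_mu_affine[OF zinb.quadratic_product_axioms]
      lp_right_mu_lam_affine[OF zinb.quadratic_product_axioms]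
      quad_form_lam_mu_add quad_form_lam_mu_eq_iff
    by (simp add: product_simps succ_simps)
qed

theorem pre_poisson_conformal_iff_pre_pgd:
  "pre_poisson_conformal_algebra (free_act scale) circ zinb.circ \<longleftrightarrow>
    pre_pgd_algebra scale (\<lhd>) (\<rhd>) (\<succ>) (\<diamond>)"
proof
  assume "pre_poisson_conformal_algebra (free_act scale) circ zinb.circ"
  then interpret P: pre_poisson_conformal_algebra "free_act scale" circ zinb.circ .
  interpret pre_gd_algebra scale "(\<lhd>)" "(\<rhd>)" "(\<diamond>)"
    using P.circ.left_symmetric_conformal_algebra_axioms left_symmetric_conformal_iff_pre_gd by blast
  interpret zinbiel_algebra scale "(\<succ>)"
    using P.succ.zinbiel_conformal_algebra_axioms zinbiel_conformal_iff_zinbiel by blast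
  note c1 = pre_poisson_conformal_1_iff[THEN iffD1, rule_format, OF P.pre_poisson_conformal_1]
  note c2 = pre_poisson_conformal_2_iff[THEN iffD1, rule_format, OF P.pre_poisson_conformal_2]
  show "pre_pgd_algebra scale (\<lhd>) (\<rhd>) (\<succ>) (\<diamond>)"
  proof unfold_locales
    fix a b c
    show "(a \<succ> b + b \<succ> a) \<rhd> c = a \<succ> (b \<rhd> c)" using c2[where a = a and b = b and c = c] by blast
    show "(a \<succ> c) \<lhd> b = a \<succ> (c \<lhd> b)" using c1[where a = b and b = a and c = c] by simp
    show "a \<succ> (c \<lhd> b) = (a \<lhd> b + a \<rhd> b) \<succ> c" using c1[where a = b and b = a and c = c] by simp
    show "a \<rhd> (b \<succ> c) = (a \<lhd> b + a \<rhd> b) \<succ> c + b \<succ> (a \<rhd> c)" using c1[where a = a and b = b and c = c] by simp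
    show "c \<lhd> (a \<succ> b + b \<succ> a) = b \<succ> (c \<lhd> a) + a \<succ> (c \<lhd> b)"
      using c2[where a = a and b = b and c = c] by (simp add: add.commute)
    show "(a \<diamond> b - b \<diamond> a) \<succ> c = a \<diamond> (b \<succ> c) - b \<succ> (a \<diamond> c)" using c1[where a = a and b = b and c = c] by blast
    show "(a \<succ> b + b \<succ> a) \<diamond> c = a \<succ> (b \<diamond> c) + b \<succ> (a \<diamond> c)" using c2[where a = a and b = b and c = c] by blast
  qed
next
  assume "pre_pgd_algebra scale (\<lhd>) (\<rhd>) (\<succ>) (\<diamond>)"
  then interpret A: pre_pgd_algebra scale "(\<lhd>)" "(\<rhd>)" "(\<succ>)" "(\<diamond>)" .
  have L: "left_symmetric_conformal_algebra (free_act scale) circ"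
    using left_symmetric_conformal_iff_pre_gd A.pre_gd_algebra_axioms by blast
  have Z: "zinbiel_conformal_algebra (free_act scale) zinb.circ"
    using zinbiel_conformal_iff_zinbiel A.zinbiel_algebra_axioms by blast
  show "pre_poisson_conformal_algebra (free_act scale) circ zinb.circ"
    unfolding pre_poisson_conformal_algebra_def pre_poisson_conformal_algebra_axioms_def
      pre_poisson_conformal_1_iff pre_poisson_conformal_2_iff
  proof (intro conjI L Z allI)
    fix a b c
    show "b \<succ> (c \<lhd> a) = (b \<succ> c) \<lhd> a" by (rule A.pre_dnp_2[symmetric])
    show "(a \<lhd> b + a \<rhd> b) \<succ> c = a \<rhd> (b \<succ> c) - b \<succ> (a \<rhd> c)"
      using A.pre_dnp_4[of a b c] by simp
    show "(b \<succ> c) \<lhd> a = (b \<lhd> a + b \<rhd> a) \<succ> c"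
      using A.pre_dnp_2[of b c a] A.pre_dnp_3[of b c a] by simp
    show "(a \<diamond> b - b \<diamond> a) \<succ> c = a \<diamond> (b \<succ> c) - b \<succ> (a \<diamond> c)" by (rule A.pre_poisson_1)
    show "c \<lhd> (a \<succ> b + b \<succ> a) = a \<succ> (c \<lhd> b) + b \<succ> (c \<lhd> a)"
      using A.pre_dnp_5[of c a b] by (simp add: add.commute)
    show "(a \<succ> b + b \<succ> a) \<rhd> c = b \<succ> (a \<rhd> c)"
      using A.pre_dnp_1[of b a c] by (simp add: add.commute)
    show "(a \<succ> b + b \<succ> a) \<rhd> c = a \<succ> (b \<rhd> c)" by (rule A.pre_dnp_1)
    show "(a \<succ> b + b \<succ> a) \<diamond> c = a \<succ> (b \<diamond> c) + b \<succ> (a \<diamond> c)" by (rule A.pre_poisson_2)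
  qed
qed

end

theorem proposition5p18:
  fixes scale :: "'k::field_char_0 \<Rightarrow> 'a::ab_group_add \<Rightarrow> 'a"
    and Basis :: "'a set"
    and lhd :: "'a \<Rightarrow> 'a \<Rightarrow> 'a" (infixl "\<lhd>" 70)
    and rhd :: "'a \<Rightarrow> 'a \<Rightarrow> 'a" (infixl "\<rhd>" 70)
    and diamond :: "'a \<Rightarrow> 'a \<Rightarrow> 'a" (infixl "\<diamond>" 70)
    and succ :: "'a \<Rightarrow> 'a \<Rightarrow> 'a" (infixl "\<succ>" 70)
  assumes "finite_dimensional_vector_space scale Basis"
    and "bilinear_map scale scale (\<lhd>)"
    and "bilinear_map scale scale (\<rhd>)"
    and "bilinear_map scale scale (\<diamond>)"
    and "bilinear_map scale scale (\<succ>)"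
  shows "pre_poisson_conformal_algebra (free_act scale)
      (sesquilinear_ext (\<lambda>a b.
        monom (free_act scale [:0, 1:] [:b \<lhd> a:]) 0
        + monom [:a \<rhd> b + b \<lhd> a:] 1
        + monom [:a \<diamond> b:] 0))
      (sesquilinear_ext (\<lambda>a b. monom [:a \<succ> b:] 0))
    \<longleftrightarrow> pre_pgd_algebra scale (\<lhd>) (\<rhd>) (\<succ>) (\<diamond>)"
proof -
  have V: "vector_space scale"
    using assms(1) by (rule finite_dimensional_vector_space.axioms(1))
  interpret four_products scale "(\<lhd>)" "(\<rhd>)" "(\<diamond>)" "(\<succ>)"
    using assms V by (intro four_products.intro quadratic_product.intro
        quadratic_product_axioms.intro four_products_axioms.intro)
  have "monom (free_act scale [:0, 1:] [:b \<lhd> a:]) 0 + monom [:a \<rhd> b + b \<lhd> a:] 1 + monom [:a \<diamond> b:] 0 =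
      affine_poly (a \<diamond> b) (b \<lhd> a) (a \<rhd> b + b \<lhd> a)" for a b
    by (simp add: affine_poly_def partial_eq monom_0 monom_Suc)
  \<comment> \<open>The sum \<open>0 + 0\<close> is \<open>a \<rhd> b + b \<lhd> a\<close> in the instance \<open>\<lhd> = \<rhd> = 0\<close>.\<close>
  moreover have "monom [:a \<succ> b:] 0 = affine_poly (a \<succ> b) 0 (0 + 0)" for a b
    by (simp add: affine_poly_def monom_0)
  ultimately show ?thesis
    using pre_poisson_conformal_iff_pre_pgd by (simp only: circ_def zinb.circ_def)
qed

end
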